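(* Let $\rho\in(0,1]$ and let $\mu$ be any source with maximal correlation $\rho$. Every (possibly partial) Boolean function $f$ that has $(1/3)$-error two-way (interactive) communication complexity $c$ bits with perfect (public) randomness has, for every $\delta>0$, a $\delta$-error zero-communication protocol with $\mu$-randomness using at most $2^{O(c)}\cdot\log(1/\delta)/\rho^2$ bits.
   Context: The maximal correlation of a distribution $\mu$ of $(X,Y)$ is $\sup\mathbb E[F(X)G(Y)]$ over real functions $F,G$ with $\mathbb E F(X)=\mathbb E G(Y)=0$ and $\mathrm{Var}\,F(X)=\mathrm{Var}\,G(Y)=1$. With $\mu$-randomness, Alice and Bob (who hold inputs $x$ and $y$) additionally receive respectively the $X$- and $Y$-components of arbitrarily many i.i.d. samples from $\mu$. A zero-communication (simultaneous message) protocol: Alice and Bob each send a single message, depending on their input and their randomness, to a referee, who outputs the answer; its cost is the total number of bits sent; it has $\delta$-error if on every input in the domain of $f$ the referee's output equals $f(x,y)$ with probability at least $1-\delta$.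
   Formalization: The bit bound is proved as max(1, 2^(20c)·log₂(1/δ)/ρ²): for δ ≤ 1/2 this is the stated bound, while for δ > 1/2, where log(1/δ) is near 0 or negative and the stated bound can fail, one bit is allowed. *)

theory Defs
  imports "HOL-Probability.Probability"
begin

text \<open>
  A source is a probability measure \<open>\<mu>\<close> on the product of two measurable spaces \<open>S\<close> and \<open>T\<close>;
  \<open>X\<close> and \<open>Y\<close> are the projections.  The supremum is taken in the extended reals, so that it is
  \<open>-\<infinity>\<close> when there is no admissible pair, i.e. when every measurable function of \<open>X\<close>, or every one
  of \<open>Y\<close>, is almost surely constant.
\<close>

definition standardized :: "'c measure \<Rightarrow> ('c \<Rightarrow> real) \<Rightarrow> bool" where
  "standardized M Z \<longleftrightarrow>
     integrable M (\<lambda>z. (Z z)\<^sup>2) \<and> prob_space.expectation M Z = 0 \<and> prob_space.variance M Z = 1"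

definition maximal_correlation :: "'a measure \<Rightarrow> 'b measure \<Rightarrow> ('a \<times> 'b) measure \<Rightarrow> ereal" where
  "maximal_correlation S T \<mu> =
     (SUP (F, G) \<in> {(F, G). F \<in> borel_measurable S \<and> G \<in> borel_measurable T \<and>
                          standardized \<mu> (\<lambda>z. F (fst z)) \<and> standardized \<mu> (\<lambda>z. G (snd z))}.
        ereal (prob_space.expectation \<mu> (\<lambda>z. F (fst z) * G (snd z))))"

text \<open>
  Deterministic two-way protocols as trees: at an inner node the named player announces one bit
  computed from his or her own input (the node is determined by the bits sent so far).
\<close>

datatype ('x, 'y) protocol =
    Answer bool
  | Alice "'x \<Rightarrow> bool" "('x, 'y) protocol" "('x, 'y) protocol"
  | Bob "'y \<Rightarrow> bool" "('x, 'y) protocol" "('x, 'y) protocol"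

primrec run :: "('x, 'y) protocol \<Rightarrow> 'x \<Rightarrow> 'y \<Rightarrow> bool" where
  "run (Answer v) x y = v"
| "run (Alice q l r) x y = (if q x then run r x y else run l x y)"
| "run (Bob q l r) x y = (if q y then run r x y else run l x y)"

primrec height :: "('x, 'y) protocol \<Rightarrow> nat" where
  "height (Answer v) = 0"
| "height (Alice q l r) = Suc (max (height l) (height r))"
| "height (Bob q l r) = Suc (max (height l) (height r))"

text \<open>
  A public-coin protocol is a probability distribution over deterministic protocols.  A partial
  Boolean function is a map into \<^typ>\<open>bool option\<close>; inputs outside its domain carry no
  requirement.
\<close>

definition public_coin_computes ::
    "real \<Rightarrow> ('x \<times> 'y \<rightharpoonup> bool) \<Rightarrow> ('x, 'y) protocol pmf \<Rightarrow> bool" where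
  "public_coin_computes \<epsilon> f P \<longleftrightarrow>
     (\<forall>x y v. f (x, y) = Some v \<longrightarrow> measure_pmf.prob P {t. run t x y = v} \<ge> 1 - \<epsilon>)"

definition public_coin_cost :: "('x, 'y) protocol pmf \<Rightarrow> enat" where
  "public_coin_cost P = (SUP t \<in> set_pmf P. enat (height t))"

definition public_coin_cc :: "real \<Rightarrow> ('x \<times> 'y \<rightharpoonup> bool) \<Rightarrow> enat" where
  "public_coin_cc \<epsilon> f = (INF P \<in> {P. public_coin_computes \<epsilon> f P}. public_coin_cost P)"

text \<open>
  Simultaneous-message protocols with \<open>\<mu>\<close>-randomness.  The protocol fixes a number \<open>N\<close> of i.i.d.
  samples; Alice sees only their first components, Bob only the second ones.  Both send
  bit strings of fixed lengths \<open>k\<close> and \<open>l\<close>.  Apart from the samples there is no randomness, neither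
  for the players nor for the referee.
\<close>

definition has_smp_protocol ::
    "'a measure \<Rightarrow> 'b measure \<Rightarrow> ('a \<times> 'b) measure \<Rightarrow> ('x \<times> 'y \<rightharpoonup> bool) \<Rightarrow> real \<Rightarrow> nat \<Rightarrow> bool" where
  "has_smp_protocol S T \<mu> f \<delta> bits \<longleftrightarrow>
     (\<exists>(N::nat) (k::nat) (l::nat) (alice :: 'x \<Rightarrow> (nat \<Rightarrow> 'a) \<Rightarrow> bool list)
        (bob :: 'y \<Rightarrow> (nat \<Rightarrow> 'b) \<Rightarrow> bool list) (referee :: bool list \<Rightarrow> bool list \<Rightarrow> bool).
        bits = k + l \<and>
        (\<forall>x. alice x \<in> measurable (PiM {..<N} (\<lambda>_. S)) (count_space UNIV)) \<and>
        (\<forall>y. bob y \<in> measurable (PiM {..<N} (\<lambda>_. T)) (count_space UNIV)) \<and>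
        (\<forall>x s. length (alice x s) = k) \<and>
        (\<forall>y t. length (bob y t) = l) \<and>
        (\<forall>x y v. f (x, y) = Some v \<longrightarrow>
           measure (PiM {..<N} (\<lambda>_. \<mu>))
             {\<omega> \<in> space (PiM {..<N} (\<lambda>_. \<mu>)).
                referee (alice x (\<lambda>i\<in>{..<N}. fst (\<omega> i))) (bob y (\<lambda>i\<in>{..<N}. snd (\<omega> i))) = v}
           \<ge> 1 - \<delta>))"

text \<open>
  The bound on the number of bits is stated with an explicit constant in the exponent of \<open>2^O(c)\<close>:
  an existentially quantified one could depend on the types of the inputs and of the samples.
  It is stated as \<open>max 1 (2^(20c) log(1/\<delta>) / \<rho>\<^sup>2)\<close>; the maximum is void for \<open>\<delta> \<le> 1/2\<close>, and for larger
  \<open>\<delta>\<close> it provides for values of \<open>log(1/\<delta>)\<close> that are close to \<open>0\<close> or negative.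
\<close>

end

theory Submission
  imports Defs
begin

text \<open>
  A deterministic protocol of height \<open>c\<close> splits the inputs into at most \<open>2^c\<close> rectangles, one per
  leaf, so its \<open>\<plusminus>1\<close>-valued answer is the sum of \<open>\<plusminus>[x \<in> A\<^sub>j] [y \<in> B\<^sub>j]\<close> over the leaves. Replace the
  public coin by a large list of protocols with nearly the right frequencies, and collect all leaves
  \<open>j\<close> of the list. Every leaf gets its own fresh pair \<open>(X\<^sub>j, Y\<^sub>j)\<close> of symmetrised values of functions
  \<open>F, G\<close> that almost attain the maximal correlation. With a small \<open>\<epsilon>\<close>, Alice forms
  \<open>A = \<epsilon> \<Sum>[x \<in> A\<^sub>j] X\<^sub>j\<close> and Bob \<open>B = \<epsilon> \<Sum>\<plusminus>[y \<in> B\<^sub>j] Y\<^sub>j\<close>. Since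
  \<open>sin A sin B = (cos (A - B) - cos (A + B)) / 2\<close> and \<open>A \<plusminus> B\<close> are sums of independent symmetric
  variables, \<open>E (sin A sin B)\<close> is half the difference of two products of cosine moments. The two
  products differ only at leaves consistent with both inputs, whence the correlation has the sign
  of the correct answer and absolute value at least of order \<open>\<rho> 2^(-c)\<close>: no central limit theorem
  is needed. Each player rounds the sine to one bit, with private randomness taken from further
  samples, and the referee takes a majority vote over \<open>O(2^(2c) log (1/\<delta>) / \<rho>\<^sup>2)\<close> repetitions of
  comparing the two bits.
\<close>

subsection \<open>Finitely supported distributions and the protocols they simulate\<close>

lemma expectation_pair_pmf_finite:
  fixes F :: "'a \<times> 'b \<Rightarrow> real"
  assumes "finite (set_pmf p)" and "finite (set_pmf q)"
  shows "measure_pmf.expectation (pair_pmf p q) F =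
    measure_pmf.expectation p (\<lambda>x. measure_pmf.expectation q (\<lambda>y. F (x, y)))"
proof -
  have "measure_pmf.expectation (pair_pmf p q) F =
      (\<Sum>(x, y)\<in>set_pmf p \<times> set_pmf q. F (x, y) * (pmf p x * pmf q y))"
    using assms by (subst integral_measure_pmf_real[of "set_pmf p \<times> set_pmf q"])
      (auto simp: pmf_pair set_pmf_iff intro!: sum.cong)
  also have "\<dots> = (\<Sum>x\<in>set_pmf p. (\<Sum>y\<in>set_pmf q. F (x, y) * pmf q y) * pmf p x)"
    by (subst sum.cartesian_product[symmetric]) (simp add: sum_distrib_right sum_distrib_left mult_ac)
  also have "\<dots> = measure_pmf.expectation p (\<lambda>x. measure_pmf.expectation q (\<lambda>y. F (x, y)))"
    using assms by (subst integral_measure_pmf_real[of "set_pmf p"])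
      (auto simp: set_pmf_iff intro!: sum.cong integral_measure_pmf_real[symmetric])
  finally show ?thesis .
qed

lemma expectation_pair_pmf_mult:
  fixes f :: "'a \<Rightarrow> real" and g :: "'b \<Rightarrow> real"
  assumes "finite (set_pmf p)" and "finite (set_pmf q)"
  shows "measure_pmf.expectation (pair_pmf p q) (\<lambda>z. f (fst z) * g (snd z)) =
    measure_pmf.expectation p f * measure_pmf.expectation q g"
  using assms by (simp add: expectation_pair_pmf_finite)

lemma replicate_pmf_Suc_pair:
  "replicate_pmf (Suc n) p = map_pmf (\<lambda>(x, xs). x # xs) (pair_pmf p (replicate_pmf n p))"
  by (simp add: pair_pmf_def map_pmf_def bind_assoc_pmf bind_return_pmf)

lemma finite_set_replicate_pmf:
  assumes "finite (set_pmf p)"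
  shows "finite (set_pmf (replicate_pmf n p))"
  using finite_lists_length_eq[OF assms, of n] by (simp add: set_replicate_pmf in_lists_conv_set subset_iff conj_commute Ball_def)

lemma expectation_replicate_pmf_prod_list:
  fixes \<phi> :: "'a \<Rightarrow> real"
  assumes "finite (set_pmf p)"
  shows "measure_pmf.expectation (replicate_pmf n p) (\<lambda>xs. prod_list (map \<phi> xs)) =
    measure_pmf.expectation p \<phi> ^ n"
proof (induction n)
  case (Suc n)
  show ?case
    unfolding replicate_pmf_Suc_pair integral_map_pmf
    using expectation_pair_pmf_mult[OF assms finite_set_replicate_pmf[OF assms],
        of n \<phi> "\<lambda>xs. prod_list (map \<phi> xs)"]
    by (simp add: Suc case_prod_unfold)
qed simp

text \<open>
  With \<open>N\<close> samples from \<open>\<nu>\<close>, players holding \<open>x\<close> and \<open>y\<close> can produce, without communication, a pair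
  distributed as \<open>D x y\<close>; \<open>N\<close> may not depend on the inputs.
\<close>

definition simulates :: "('s \<times> 't) pmf \<Rightarrow> ('x \<Rightarrow> 'y \<Rightarrow> ('m \<times> 'n) pmf) \<Rightarrow> bool" where
  "simulates \<nu> D \<longleftrightarrow> (\<exists>N \<alpha> \<beta>. \<forall>x y. D x y =
     map_pmf (\<lambda>zs. (\<alpha> x (map fst zs), \<beta> y (map snd zs))) (replicate_pmf N \<nu>))"

lemma simulates_const: "simulates \<nu> (\<lambda>_ _. return_pmf (a, b))"
  unfolding simulates_def by (rule exI[of _ 0]) auto

lemma simulates_self: "simulates \<nu> (\<lambda>_ _. \<nu>)"
  unfolding simulates_def
  by (intro exI[of _ 1] exI[of _ "\<lambda>_. hd"]) (simp only: replicate_pmf_1 pmf.map_comp, simp add: o_def)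

lemma simulates_map_prod:
  assumes "simulates \<nu> D"
  shows "simulates \<nu> (\<lambda>x y. map_pmf (map_prod (g x) (h y)) (D x y))"
proof -
  obtain N \<alpha> \<beta> where "\<And>x y. D x y =
      map_pmf (\<lambda>zs. (\<alpha> x (map fst zs), \<beta> y (map snd zs))) (replicate_pmf N \<nu>)"
    using assms unfolding simulates_def by blast
  then show ?thesis
    unfolding simulates_def
    by (intro exI[of _ N] exI[of _ "\<lambda>x zs. g x (\<alpha> x zs)"] exI[of _ "\<lambda>y zs. h y (\<beta> y zs)"])
      (simp add: map_pmf_comp)
qed

text \<open>Disjoint blocks of samples are independent: the first \<open>N\<close> samples go to
  \<open>D\<close>, the other \<open>N'\<close> to \<open>D'\<close>. Both players cut at the same
  place because \<open>N\<close> is common to all inputs.\<close>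

lemma simulates_pair:
  assumes "simulates \<nu> D" and "simulates \<nu> D'"
  shows "simulates \<nu> (\<lambda>x y. map_pmf (\<lambda>((a, b), (a', b')). ((a, a'), (b, b')))
    (pair_pmf (D x y) (D' x y)))"
proof -
  obtain N \<alpha> \<beta> where 1: "\<And>x y. D x y =
      map_pmf (\<lambda>zs. (\<alpha> x (map fst zs), \<beta> y (map snd zs))) (replicate_pmf N \<nu>)"
    using assms unfolding simulates_def by blast
  obtain N' \<alpha>' \<beta>' where 2: "\<And>x y. D' x y =
      map_pmf (\<lambda>zs. (\<alpha>' x (map fst zs), \<beta>' y (map snd zs))) (replicate_pmf N' \<nu>)"
    using assms unfolding simulates_def by blast
  have len: "length zs = N" if "zs \<in> set_pmf (replicate_pmf N \<nu>)" for zs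
    using that by (simp add: set_replicate_pmf)
  show ?thesis
    unfolding simulates_def
  proof (intro exI allI)
    fix x y
    show "map_pmf (\<lambda>((a, b), (a', b')). ((a, a'), (b, b'))) (pair_pmf (D x y) (D' x y)) =
      map_pmf (\<lambda>zs. ((\<lambda>x zs. (\<alpha> x (take N zs), \<alpha>' x (drop N zs))) x (map fst zs),
        (\<lambda>y zs. (\<beta> y (take N zs), \<beta>' y (drop N zs))) y (map snd zs))) (replicate_pmf (N + N') \<nu>)"
      unfolding 1 2 replicate_pmf_distrib pair_pmf_def map_pmf_def
      by (auto simp: bind_assoc_pmf bind_return_pmf take_map[symmetric] drop_map[symmetric] len
          intro!: bind_pmf_cong)
  qed
qed

text \<open>Each repetition uses a fresh block of samples. The result is a pair of lists rather than
  a list of pairs because each player holds only one half of it.\<close>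

lemma simulates_replicate:
  assumes "simulates \<nu> D"
  shows "simulates \<nu> (\<lambda>x y. map_pmf (\<lambda>zs. (map fst zs, map snd zs)) (replicate_pmf n (D x y)))"
proof (induction n)
  case 0
  show ?case by (simp add: simulates_const)
next
  case (Suc n)
  have "map_pmf (\<lambda>zs. (map fst zs, map snd zs)) (replicate_pmf (Suc n) (D x y)) =
      map_pmf (map_prod (\<lambda>(a, as). a # as) (\<lambda>(b, bs). b # bs))
       (map_pmf (\<lambda>((a, b), (a', b')). ((a, a'), (b, b')))
         (pair_pmf (D x y) (map_pmf (\<lambda>zs. (map fst zs, map snd zs)) (replicate_pmf n (D x y)))))"
    for x y
    unfolding replicate_pmf_Suc_pair pair_map_pmf2 map_pmf_comp
    by (rule map_pmf_cong) auto
  then show ?case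
    using simulates_map_prod[OF simulates_pair[OF assms Suc.IH],
        of "\<lambda>_ (a, as). a # as" "\<lambda>_ (b, bs). b # bs"]
    by simp
qed

text \<open>Finite support makes every real function integrable under whatever the players
  simulate.\<close>

lemma finite_set_pmf_simulates:
  assumes "simulates \<nu> D" and "finite (set_pmf \<nu>)"
  shows "finite (set_pmf (D x y))"
proof -
  obtain N \<alpha> \<beta> where "\<And>x y. D x y =
      map_pmf (\<lambda>zs. (\<alpha> x (map fst zs), \<beta> y (map snd zs))) (replicate_pmf N \<nu>)"
    using assms unfolding simulates_def by blast
  then show ?thesis
    using finite_set_replicate_pmf[OF assms(2)] by simp
qed

section \<open>Signs and a Chernoff bound for majority votes\<close>

definition spin :: "bool \<Rightarrow> real" where
  "spin b = (if b then 1 else -1)"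

lemma spin_mult: "spin a * spin b = spin (a = b)"
  by (simp add: spin_def)

lemma expectation_spin:
  "measure_pmf.expectation p (\<lambda>z. spin (z \<in> A)) = 2 * measure_pmf.prob p A - 1"
proof -
  have "measure_pmf.expectation p (\<lambda>z. spin (z \<in> A)) = measure_pmf.expectation p (\<lambda>z. 2 * indicator A z - 1)"
    by (intro Bochner_Integration.integral_cong) (auto simp: spin_def)
  also have "\<dots> = 2 * measure_pmf.prob p A - 1"
    by (subst Bochner_Integration.integral_diff) (auto simp: measure_pmf.emeasure_eq_measure)
  finally show ?thesis .
qed

text \<open>Markov's inequality for the product of the weights
  \<open>(1 + m) powr (- spin (q z))\<close>, which is at least 1 when the signs sum to at most 0.
  Ties count as errors.\<close>

lemma prob_majority_error:
  fixes q :: "'a \<Rightarrow> bool"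
  assumes fin: "finite (set_pmf p)" and m: "0 \<le> m"
    and mean: "measure_pmf.expectation p (\<lambda>z. spin (q z)) \<ge> m"
  shows "measure_pmf.prob (replicate_pmf n p) {zs. (\<Sum>z\<leftarrow>zs. spin (q z)) \<le> 0} \<le> exp (- (m\<^sup>2 * n / 2))"
proof -
  \<comment> \<open>The base \<open>1 + m\<close> replaces an optimisation over the exponential
    parameter: for signs of mean \<open>m\<close> the mean weight is exactly
    \<open>1 - m\<^sup>2 / 2\<close>.\<close>
  define \<phi> where "\<phi> z = (if q z then 1 / (1 + m) else 1 + m)" for z
  \<comment> \<open>A sign takes only two values, so the weight is affine in it and the mean sign
    determines the mean weight.\<close>
  have lin: "\<phi> z = (1 / (1 + m) + (1 + m)) / 2 - ((1 + m) - 1 / (1 + m)) / 2 * spin (q z)" for z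
    by (simp add: \<phi>_def spin_def field_simps)
  have inte: "integrable (measure_pmf p) h" for h :: "'a \<Rightarrow> real"
    using fin by (rule integrable_measure_pmf_finite)
  have "measure_pmf.expectation p \<phi> = (1 / (1 + m) + (1 + m)) / 2
     - ((1 + m) - 1 / (1 + m)) / 2 * measure_pmf.expectation p (\<lambda>z. spin (q z))"
    unfolding lin using inte by simp
  also have "\<dots> \<le> (1 / (1 + m) + (1 + m)) / 2 - ((1 + m) - 1 / (1 + m)) / 2 * m"
  proof -
    have "1 / (1 + m) \<le> 1" using m by simp
    then have "1 / (1 + m) \<le> 1 + m" using m by linarith
    then show ?thesis using mean m by (intro diff_left_mono mult_left_mono) auto
  qed
  also have "\<dots> = 1 - m\<^sup>2 / 2"
  proof -
    have "(1 / k + k) / 2 - (k - 1 / k) / 2 * (k - 1) = 1 - (k - 1)\<^sup>2 / 2" if "k > 0" for k :: real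
      using that by (simp add: divide_simps) (simp add: power2_eq_square algebra_simps)
    from this[of "1 + m"] m show ?thesis by simp
  qed
  also have "\<dots> \<le> exp (- (m\<^sup>2 / 2))"
    using exp_ge_add_one_self[of "- (m\<^sup>2 / 2)"] by simp
  finally have E: "measure_pmf.expectation p \<phi> \<le> exp (- (m\<^sup>2 / 2))" .
  have \<phi>_eq: "\<phi> z = (1 + m) powr (- spin (q z))" for z
    using m by (simp add: \<phi>_def spin_def powr_minus_divide)
  have pos: "0 \<le> \<phi> z" for z using m by (simp add: \<phi>_def)
  have prod: "prod_list (map \<phi> zs) = (1 + m) powr (- (\<Sum>z\<leftarrow>zs. spin (q z)))" for zs
    using m by (induction zs) (simp_all add: \<phi>_eq powr_add[symmetric])
  have finr: "integrable (measure_pmf (replicate_pmf n p)) h" for h :: "'a list \<Rightarrow> real"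
    using finite_set_replicate_pmf[OF fin] by (rule integrable_measure_pmf_finite)
  have "measure_pmf.prob (replicate_pmf n p) {zs. (\<Sum>z\<leftarrow>zs. spin (q z)) \<le> 0} =
      measure_pmf.expectation (replicate_pmf n p) (indicator {zs. (\<Sum>z\<leftarrow>zs. spin (q z)) \<le> 0})"
    by simp
  also have "\<dots> \<le> measure_pmf.expectation (replicate_pmf n p) (\<lambda>zs. prod_list (map \<phi> zs))"
    using m by (intro integral_mono finr) (auto simp: prod indicator_def ge_one_powr_ge_zero)
  also have "\<dots> = measure_pmf.expectation p \<phi> ^ n"
    by (rule expectation_replicate_pmf_prod_list[OF fin])
  also have "\<dots> \<le> exp (- (m\<^sup>2 / 2)) ^ n"
    by (intro power_mono E Bochner_Integration.integral_nonneg pos)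
  also have "\<dots> = exp (- (m\<^sup>2 * n / 2))"
    by (simp add: exp_of_nat_mult[symmetric] field_simps)
  finally show ?thesis .
qed

section \<open>Random bits of prescribed bias from samples\<close>

text \<open>
  Splitting off one sample at a time: if \<open>q \<le> P(E)\<close>, the event is sought inside \<open>E\<close>, otherwise
  \<open>E\<close> is taken whole and the rest is sought outside.
\<close>

lemma approx_prob_replicate_pmf:
  fixes p :: "'a pmf"
  assumes fin: "finite (set_pmf p)" and q: "0 \<le> q" "q \<le> 1"
    and r: "measure_pmf.prob p E \<le> r" "1 - measure_pmf.prob p E \<le> r"
    and ne: "0 < measure_pmf.prob p E" "measure_pmf.prob p E < 1"
  shows "\<exists>W. \<bar>measure_pmf.prob (replicate_pmf n p) W - q\<bar> \<le> r ^ n"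
  using q
proof (induction n arbitrary: q)
  case 0
  then show ?case by (intro exI[of _ "{}"]) simp
next
  case (Suc n)
  define e where "e = measure_pmf.prob p E"
  have e: "0 < e" "e < 1" "e \<le> r" "1 - e \<le> r" using r ne by (auto simp: e_def)
  have split: "measure_pmf.prob (replicate_pmf (Suc n) p) {zs. if hd zs \<in> E then tl zs \<in> A else tl zs \<in> B}
      = e * measure_pmf.prob (replicate_pmf n p) A + (1 - e) * measure_pmf.prob (replicate_pmf n p) B" for A B
  proof -
    let ?R = "replicate_pmf n p"
    note finR = finite_set_replicate_pmf[OF fin, of n]
    have "measure_pmf.prob (replicate_pmf (Suc n) p) {zs. if hd zs \<in> E then tl zs \<in> A else tl zs \<in> B}
       = measure_pmf.expectation (pair_pmf p ?R) (\<lambda>z. indicator {zs. if hd zs \<in> E then tl zs \<in> A else tl zs \<in> B} (fst z # snd z))"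
      unfolding replicate_pmf_Suc_pair
      by (subst integral_map_pmf[symmetric, where g="\<lambda>z. fst z # snd z"]) (simp add: case_prod_unfold)
    also have "\<dots> = measure_pmf.expectation (pair_pmf p ?R) (\<lambda>z. indicator E (fst z) * indicator A (snd z)
         + indicator (-E) (fst z) * indicator B (snd z))"
      by (intro Bochner_Integration.integral_cong) (auto simp: indicator_def)
    also have "\<dots> = e * measure_pmf.prob ?R A + measure_pmf.prob p (-E) * measure_pmf.prob ?R B"
      using expectation_pair_pmf_mult[OF fin finR, of "indicator E" "indicator A"]
        expectation_pair_pmf_mult[OF fin finR, of "indicator (-E)" "indicator B"]
      by (subst Bochner_Integration.integral_add)
        (use fin finR in \<open>auto intro!: integrable_measure_pmf_finite simp: e_def\<close>)
    also have "measure_pmf.prob p (-E) = 1 - e"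
      using measure_pmf.prob_compl[of E p] by (simp add: e_def Compl_eq_Diff_UNIV)
    finally show ?thesis .
  qed
  show ?case
  proof (cases "q \<le> e")
    case True
    then obtain A where A: "\<bar>measure_pmf.prob (replicate_pmf n p) A - q / e\<bar> \<le> r ^ n"
      using Suc.IH[of "q / e"] Suc.prems e by auto
    \<comment> \<open>The induction hypothesis concerns a conditional probability; weighting its
      error by \<open>e\<close>, or by \<open>1 - e\<close> in the other case, gains a factor of at
      most \<open>r\<close>.\<close>
    have "\<bar>e * measure_pmf.prob (replicate_pmf n p) A - q\<bar> = e * \<bar>measure_pmf.prob (replicate_pmf n p) A - q / e\<bar>"
      using e by (simp add: abs_mult_pos[symmetric] abs_mult field_simps)
    also have "\<dots> \<le> r * r ^ n" using e A by (intro mult_mono) auto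
    finally show ?thesis using split[of A "{}"]
      by (intro exI[of _ "{zs. if hd zs \<in> E then tl zs \<in> A else tl zs \<in> {}}"])
        (simp del: replicate_pmf.simps)
  next
    case False
    then obtain B where B: "\<bar>measure_pmf.prob (replicate_pmf n p) B - (q - e) / (1 - e)\<bar> \<le> r ^ n"
      using Suc.IH[of "(q - e) / (1 - e)"] Suc.prems e by auto
    have "\<bar>e + (1 - e) * measure_pmf.prob (replicate_pmf n p) B - q\<bar>
       = \<bar>(1 - e) * (measure_pmf.prob (replicate_pmf n p) B - (q - e) / (1 - e))\<bar>"
    proof -
      have "(1 - e) * ((q - e) / (1 - e)) = q - e" using e by simp
      then show ?thesis by (simp add: right_diff_distrib)
    qed
    also have "\<dots> = (1 - e) * \<bar>measure_pmf.prob (replicate_pmf n p) B - (q - e) / (1 - e)\<bar>"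
      using e by (simp add: abs_mult)
    also have "\<dots> \<le> r * r ^ n" using e B by (intro mult_mono) auto
    finally show ?thesis using split[of UNIV B]
      by (intro exI[of _ "{zs. if hd zs \<in> E then tl zs \<in> UNIV else tl zs \<in> B}"])
        (simp del: replicate_pmf.simps)
  qed
qed

lemma nontrivial_prob_singleton:
  assumes "x \<in> set_pmf p" and "y \<in> set_pmf p" and "x \<noteq> y"
  shows "0 < measure_pmf.prob p {x}" and "measure_pmf.prob p {x} < 1"
proof -
  show "0 < measure_pmf.prob p {x}" using assms by (simp add: measure_pmf_single pmf_positive)
  have "pmf p x + pmf p y = measure_pmf.prob p {x, y}"
    using assms by (simp add: measure_measure_pmf_finite)
  also have "\<dots> \<le> 1" by simp
  finally show "measure_pmf.prob p {x} < 1"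
    using assms pmf_positive[of y p] by (simp add: measure_pmf_single)
qed

text \<open>Samples stand in for private coins: an event of probability close to
  \<open>(1 + u) / 2\<close> has mean sign close to \<open>u\<close>. The error \<open>r ^ n\<close>
  does not depend on \<open>u\<close>, so one \<open>n\<close> serves all inputs.\<close>

lemma ex_randomized_rounding:
  fixes p :: "'a pmf"
  assumes fin: "finite (set_pmf p)" and xy: "x \<in> set_pmf p" "y \<in> set_pmf p" "x \<noteq> y" and \<eta>: "0 < \<eta>"
  shows "\<exists>n W. \<forall>u. \<bar>u\<bar> \<le> 1 \<longrightarrow>
    \<bar>measure_pmf.expectation (replicate_pmf n p) (\<lambda>zs. spin (zs \<in> W u)) - u\<bar> \<le> \<eta>"
proof -
  define e where "e = measure_pmf.prob p {x}"
  define r where "r = max e (1 - e)"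
  have e: "0 < e" "e < 1" using nontrivial_prob_singleton[OF xy] by (auto simp: e_def)
  have r: "0 \<le> r" "r < 1" using e by (auto simp: r_def)
  then obtain n where n: "r ^ n < \<eta> / 2"
    using real_arch_pow_inv[of "\<eta> / 2" r] \<eta> by auto
  have "\<exists>W. \<bar>measure_pmf.prob (replicate_pmf n p) W - (1 + u) / 2\<bar> \<le> r ^ n" if "\<bar>u\<bar> \<le> 1" for u :: real
    using that e by (intro approx_prob_replicate_pmf[OF fin, where E="{x}"]) (auto simp: e_def r_def)
  then obtain W where W: "\<And>u. \<bar>u\<bar> \<le> 1 \<Longrightarrow> \<bar>measure_pmf.prob (replicate_pmf n p) (W u) - (1 + u) / 2\<bar> \<le> r ^ n"
    by metis
  have "\<bar>2 * measure_pmf.prob (replicate_pmf n p) (W u) - 1 - u\<bar> \<le> \<eta>" if "\<bar>u\<bar> \<le> 1" for u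
    using W[OF that] n by (simp add: abs_le_iff field_simps)
  then show ?thesis by (intro exI[of _ n] exI[of _ W]) (simp add: expectation_spin)
qed

subsection \<open>Products of cosine moments\<close>

text \<open>The coefficients are functions rather than numbers so that the same notion covers each
  player's sum over reals and the joint sum over pairs.\<close>

definition linear_form :: "('a \<Rightarrow> real) list \<Rightarrow> 'a list \<Rightarrow> real" where
  "linear_form cs zs = (\<Sum>(c, z)\<leftarrow>zip cs zs. c z)"

lemma linear_form_Cons: "linear_form (c # cs) (z # zs) = c z + linear_form cs zs"
  by (simp add: linear_form_def)

text \<open>The real form of multiplicativity of characteristic functions: vanishing sine moments
  remove the second term of each addition formula. Both claims are proved in one induction since
  each formula involves sine and cosine.\<close>

lemma expectation_cos_linear_form:
  fixes p :: "'a pmf"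
  assumes fin: "finite (set_pmf p)"
    and sym: "\<And>c. c \<in> set cs \<Longrightarrow> measure_pmf.expectation p (\<lambda>z. sin (c z)) = 0"
  shows "measure_pmf.expectation (replicate_pmf (length cs) p) (\<lambda>zs. cos (linear_form cs zs)) =
      (\<Prod>c\<leftarrow>cs. measure_pmf.expectation p (\<lambda>z. cos (c z)))"
    and "measure_pmf.expectation (replicate_pmf (length cs) p) (\<lambda>zs. sin (linear_form cs zs)) = 0"
proof -
  have "measure_pmf.expectation (replicate_pmf (length cs) p) (\<lambda>zs. cos (linear_form cs zs)) =
      (\<Prod>c\<leftarrow>cs. measure_pmf.expectation p (\<lambda>z. cos (c z))) \<and>
    measure_pmf.expectation (replicate_pmf (length cs) p) (\<lambda>zs. sin (linear_form cs zs)) = 0"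
    using sym
  proof (induction cs)
    case Nil
    then show ?case by (simp add: linear_form_def)
  next
    case (Cons c cs)
    let ?R = "replicate_pmf (length cs) p"
    note finR = finite_set_replicate_pmf[OF fin, of "length cs"]
    have I: "integrable (measure_pmf (pair_pmf p ?R)) h" for h :: "_ \<Rightarrow> real"
      using fin finR by (intro integrable_measure_pmf_finite) auto
    note mult = expectation_pair_pmf_mult[OF fin finR]
    have "measure_pmf.expectation (replicate_pmf (length (c # cs)) p) (\<lambda>zs. cos (linear_form (c # cs) zs))
        = measure_pmf.expectation (pair_pmf p ?R) (\<lambda>z. cos (c (fst z)) * cos (linear_form cs (snd z))
            - sin (c (fst z)) * sin (linear_form cs (snd z)))"
      unfolding list.size(4) add_0_right add_Suc_right replicate_pmf_Suc_pair
      by (simp add: case_prod_unfold linear_form_Cons cos_add)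
    also have "\<dots> = (\<Prod>c\<leftarrow>c # cs. measure_pmf.expectation p (\<lambda>z. cos (c z)))"
      using Cons mult[of "\<lambda>z. cos (c z)" "\<lambda>zs. cos (linear_form cs zs)"]
        mult[of "\<lambda>z. sin (c z)" "\<lambda>zs. sin (linear_form cs zs)"]
      by (subst Bochner_Integration.integral_diff[OF I I]) simp
    finally have 1: "measure_pmf.expectation (replicate_pmf (length (c # cs)) p)
        (\<lambda>zs. cos (linear_form (c # cs) zs)) = (\<Prod>c\<leftarrow>c # cs. measure_pmf.expectation p (\<lambda>z. cos (c z)))" .
    have "measure_pmf.expectation (replicate_pmf (length (c # cs)) p) (\<lambda>zs. sin (linear_form (c # cs) zs))
        = measure_pmf.expectation (pair_pmf p ?R) (\<lambda>z. sin (c (fst z)) * cos (linear_form cs (snd z))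
            + cos (c (fst z)) * sin (linear_form cs (snd z)))"
      unfolding list.size(4) add_0_right add_Suc_right replicate_pmf_Suc_pair
      by (simp add: case_prod_unfold linear_form_Cons sin_add)
    also have "\<dots> = 0"
      using Cons mult[of "\<lambda>z. sin (c z)" "\<lambda>zs. cos (linear_form cs zs)"]
        mult[of "\<lambda>z. cos (c z)" "\<lambda>zs. sin (linear_form cs zs)"]
      by (subst Bochner_Integration.integral_add[OF I I]) simp
    finally show ?case using 1 by simp
  qed
  then show "measure_pmf.expectation (replicate_pmf (length cs) p) (\<lambda>zs. cos (linear_form cs zs)) =
      (\<Prod>c\<leftarrow>cs. measure_pmf.expectation p (\<lambda>z. cos (c z)))"
    and "measure_pmf.expectation (replicate_pmf (length cs) p) (\<lambda>zs. sin (linear_form cs zs)) = 0"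
    by auto
qed

section \<open>Differences of products that exchange two kinds of factors\<close>

text \<open>A discrete mean value estimate, from \<open>x ^ Suc k - y ^ Suc k = x * (x ^ k - y ^ k)
  + (x - y) * y ^ k\<close>. The exponent \<open>k\<close> in place of \<open>k - 1\<close> on the
  left is affordable as \<open>t \<le> 1\<close>.\<close>

lemma power_diff_lower_bound:
  fixes x y t :: real
  assumes "t \<le> y" and "y \<le> x" and "0 \<le> t" and "t \<le> 1"
  shows "k * (x - y) * t ^ k \<le> x ^ k - y ^ k"
proof (induction k)
  case (Suc k)
  have "real (Suc k) * (x - y) * t ^ Suc k = t * (real k * (x - y) * t ^ k) + (x - y) * t ^ Suc k"
    by (simp add: algebra_simps)
  also have "\<dots> \<le> x * (x ^ k - y ^ k) + (x - y) * y ^ k"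
  proof (intro add_mono mult_mono Suc.IH)
    have "t ^ Suc k \<le> t ^ k" using assms by (intro power_decreasing) auto
    also have "\<dots> \<le> y ^ k" using assms by (intro power_mono)
    finally show "t ^ Suc k \<le> y ^ k" .
  qed (use assms in auto)
  also have "\<dots> = x ^ Suc k - y ^ Suc k" by (simp add: algebra_simps)
  finally show ?case .
qed simp

text \<open>With \<open>P = Q + d\<close> the factor \<open>G * (x ^ Q * y ^ Q)\<close> is common to
  both products, and only \<open>x ^ d - y ^ d\<close> remains to be estimated.\<close>

lemma swapped_powers_diff_lower_bound:
  fixes x y t G :: real
  assumes t: "t \<le> y" "y \<le> x" "0 \<le> t" "t \<le> 1" and G: "t ^ k \<le> G" and "Q \<le> P"
  shows "(real P - real Q) * (x - y) * t ^ (k + P + Q) \<le> G * (x ^ P * y ^ Q) - G * (y ^ P * x ^ Q)"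
proof -
  obtain d where d: "P = Q + d" using \<open>Q \<le> P\<close> le_Suc_ex by blast
  have "(real P - real Q) * (x - y) * t ^ (k + P + Q) = (t ^ k * (t ^ Q * t ^ Q)) * (d * (x - y) * t ^ d)"
    by (simp add: d power_add mult_ac)
  also have "\<dots> \<le> (G * (x ^ Q * y ^ Q)) * (x ^ d - y ^ d)"
    using t G by (intro mult_mono power_mono power_diff_lower_bound mult_nonneg_nonneg) 
      (auto intro: order_trans[OF zero_le_power])
  also have "\<dots> = G * (x ^ P * y ^ Q) - G * (y ^ P * x ^ Q)"
    by (simp add: d power_add algebra_simps)
  finally show ?thesis .
qed

text \<open>A triple \<open>(a, b, v)\<close> describes one leaf: whether Alice's and Bob's inputs
  are consistent with it, and its answer. The sum is the vote of the leaves consistent with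
  both.\<close>

definition balance :: "(bool \<times> bool \<times> bool) list \<Rightarrow> real" where
  "balance js = (\<Sum>(a, b, v)\<leftarrow>js. if a \<and> b then spin v else 0)"

text \<open>Leaves not consistent with both inputs put the same factor into \<open>P1\<close> and
  \<open>P2\<close>, so the difference depends only on how many consistent leaves answer each way.
  The sign \<open>w\<close> exchanges the two answers when \<open>False\<close> is ahead.\<close>

lemma product_difference_lower_bound:
  fixes x y t :: real and g :: "bool \<Rightarrow> bool \<Rightarrow> real" and js :: "(bool \<times> bool \<times> bool) list"
  assumes t: "t \<le> y" "y \<le> x" "0 \<le> t" "t \<le> 1" and g: "\<And>a b. t \<le> g a b"
  defines "P1 \<equiv> (\<Prod>(a, b, v)\<leftarrow>js. if a \<and> b then if v then x else y else g a b)"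
    and "P2 \<equiv> (\<Prod>(a, b, v)\<leftarrow>js. if a \<and> b then if v then y else x else g a b)"
  assumes nonneg: "0 \<le> spin w * balance js"
  shows "spin w * balance js * (x - y) * t ^ length js \<le> spin w * (P1 - P2)"
proof -
  \<comment> \<open>\<open>P\<close> and \<open>Q\<close> count the consistent leaves answering
    \<open>True\<close> and \<open>False\<close>; \<open>G\<close> collects the factors of the other
    \<open>k\<close> leaves.\<close>
  have "\<exists>P Q k G. balance js = real P - real Q \<and> length js = k + P + Q \<and> t ^ k \<le> G \<and>
      P1 = G * (x ^ P * y ^ Q) \<and> P2 = G * (y ^ P * x ^ Q)"
    unfolding P1_def P2_def
  proof (induction js)
    case Nil
    then show ?case by (intro exI[of _ 0] exI[of _ 1]) (simp add: balance_def)
  next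
    case (Cons j js)
    obtain a b v where j: "j = (a, b, v)" by (cases j)
    from Cons.IH obtain P Q k G where *: "balance js = real P - real Q" "length js = k + P + Q" "t ^ k \<le> G"
      "(\<Prod>(a, b, v)\<leftarrow>js. if a \<and> b then if v then x else y else g a b) = G * (x ^ P * y ^ Q)"
      "(\<Prod>(a, b, v)\<leftarrow>js. if a \<and> b then if v then y else x else g a b) = G * (y ^ P * x ^ Q)"
      by blast
    show ?case
    proof (cases "a \<and> b")
      case True
      show ?thesis
      proof (cases v)
        case v: True
        show ?thesis
          using True v * by (intro exI[of _ "Suc P"] exI[of _ Q] exI[of _ k] exI[of _ G])
            (simp add: j balance_def spin_def mult_ac)
      next
        case v: False
        show ?thesis
          using True v * by (intro exI[of _ P] exI[of _ "Suc Q"] exI[of _ k] exI[of _ G])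
            (simp add: j balance_def spin_def mult_ac)
      qed
    next
      case False
      have "t * t ^ k \<le> g a b * G" using * g t by (intro mult_mono) (auto intro: order_trans)
      then show ?thesis
        using False * by (intro exI[of _ P] exI[of _ Q] exI[of _ "Suc k"] exI[of _ "g a b * G"])
          (auto simp: j balance_def mult_ac)
    qed
  qed
  then obtain P Q k G where *: "balance js = real P - real Q" "length js = k + P + Q" "t ^ k \<le> G"
      "P1 = G * (x ^ P * y ^ Q)" "P2 = G * (y ^ P * x ^ Q)"
    by blast
  show ?thesis
  proof (cases w)
    case True
    then have "Q \<le> P" using nonneg * by (simp add: spin_def)
    from swapped_powers_diff_lower_bound[OF t *(3) this] show ?thesis
      using True * by (simp add: spin_def)
  next
    case False
    then have "P \<le> Q" using nonneg * by (simp add: spin_def)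
    from swapped_powers_diff_lower_bound[OF t *(3) this] show ?thesis
      using False * by (simp add: spin_def add_ac mult_ac)
  qed
qed

text \<open>The analytic core: \<open>2 * sin A * sin B = cos (A - B) - cos (A + B)\<close> turns
  the correlation into a difference of two products with one factor per leaf.\<close>

lemma expectation_sin_mult_sin_lower_bound:
  fixes p :: "(real \<times> real) pmf" and js :: "(bool \<times> bool \<times> bool) list" and \<epsilon> t :: real
  assumes fin: "finite (set_pmf p)"
    and sym: "\<And>a b. measure_pmf.expectation p (\<lambda>z. sin (a * fst z + b * snd z)) = 0"
    and cos_ge: "\<And>a b. \<bar>a\<bar> \<le> \<epsilon> \<Longrightarrow> \<bar>b\<bar> \<le> \<epsilon> \<Longrightarrow>
          t \<le> measure_pmf.expectation p (\<lambda>z. cos (a * fst z + b * snd z))"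
    and t: "0 \<le> t" "t \<le> 1" and \<epsilon>: "0 \<le> \<epsilon>"
    and \<tau>: "0 \<le> measure_pmf.expectation p (\<lambda>z. sin (\<epsilon> * fst z) * sin (\<epsilon> * snd z))"
    and nonneg: "0 \<le> spin w * balance js"
  defines "A \<equiv> linear_form (map (\<lambda>(a, b, v) u. of_bool a * \<epsilon> * u) js)"
    and "B \<equiv> linear_form (map (\<lambda>(a, b, v) u. of_bool b * spin v * \<epsilon> * u) js)"
  shows "spin w * balance js * measure_pmf.expectation p (\<lambda>z. sin (\<epsilon> * fst z) * sin (\<epsilon> * snd z)) * t ^ length js
    \<le> spin w * measure_pmf.expectation (replicate_pmf (length js) p) (\<lambda>zs. sin (A (map fst zs)) * sin (B (map snd zs)))"
proof -
  let ?R = "replicate_pmf (length js) p"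
  define \<psi> where "\<psi> a b = measure_pmf.expectation p (\<lambda>z. cos (a * fst z + b * snd z))" for a b
  define \<tau> where "\<tau> = measure_pmf.expectation p (\<lambda>z. sin (\<epsilon> * fst z) * sin (\<epsilon> * snd z))"
  have Ip: "integrable (measure_pmf p) h" for h :: "_ \<Rightarrow> real"
    using fin by (rule integrable_measure_pmf_finite)
  have IR: "integrable (measure_pmf ?R) h" for h :: "_ \<Rightarrow> real"
    using finite_set_replicate_pmf[OF fin] by (rule integrable_measure_pmf_finite)
  \<comment> \<open>The same trigonometric identity for a single pair: the gap between the two kinds
    of factors is twice the correlation of the sines.\<close>
  have \<tau>_eq: "2 * \<tau> = \<psi> \<epsilon> (-\<epsilon>) - \<psi> \<epsilon> \<epsilon>"
  proof -
    have "\<psi> \<epsilon> (-\<epsilon>) - \<psi> \<epsilon> \<epsilon> = measure_pmf.expectation p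
        (\<lambda>z. cos (\<epsilon> * fst z + (-\<epsilon>) * snd z) - cos (\<epsilon> * fst z + \<epsilon> * snd z))"
      unfolding \<psi>_def by (rule Bochner_Integration.integral_diff[OF Ip Ip, symmetric])
    also have "\<dots> = measure_pmf.expectation p (\<lambda>z. 2 * (sin (\<epsilon> * fst z) * sin (\<epsilon> * snd z)))"
      by (simp add: cos_add cos_diff mult_ac)
    finally show ?thesis by (simp add: \<tau>_def)
  qed
  have \<psi>_minus: "\<psi> (-a) b = \<psi> a (-b)" for a b
  proof -
    have "cos (- (a * fst z) + b * snd z) = cos (a * fst z + - (b * snd z))" for z
      by (simp add: cos_diff mult.commute)
    then show ?thesis unfolding \<psi>_def by simp
  qed
  \<comment> \<open>The values \<open>s = -1\<close> and \<open>s = 1\<close> give the joint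
    coefficients of \<open>A - B\<close> and \<open>A + B\<close>.\<close>
  define cs where "cs s = map (\<lambda>(a, b, v) z. of_bool a * \<epsilon> * fst z + s * (of_bool b * spin v * \<epsilon>) * snd z) js" for s :: real
  have lin: "linear_form (cs s) zs = A (map fst zs) + s * B (map snd zs)" for s zs
    unfolding A_def B_def cs_def linear_form_def
    by (induction js arbitrary: zs) (auto simp: algebra_simps split: list.splits prod.splits simp: zip_Cons1 split!: list.split)
  have E_cos: "measure_pmf.expectation ?R (\<lambda>zs. cos (A (map fst zs) + s * B (map snd zs))) =
      (\<Prod>(a, b, v)\<leftarrow>js. \<psi> (of_bool a * \<epsilon>) (s * (of_bool b * spin v * \<epsilon>)))" for s
  proof -
    have "measure_pmf.expectation (replicate_pmf (length (cs s)) p) (\<lambda>zs. cos (linear_form (cs s) zs)) =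
       (\<Prod>c\<leftarrow>cs s. measure_pmf.expectation p (\<lambda>z. cos (c z)))"
      by (rule expectation_cos_linear_form[OF fin]) (auto simp: cs_def sym)
    also have "\<dots> = (\<Prod>(a, b, v)\<leftarrow>js. \<psi> (of_bool a * \<epsilon>) (s * (of_bool b * spin v * \<epsilon>)))"
      unfolding cs_def \<psi>_def map_map by (intro arg_cong[where f=prod_list] map_cong) auto
    finally show ?thesis unfolding lin by (simp add: cs_def)
  qed
  define x where "x = \<psi> \<epsilon> (-\<epsilon>)"
  define y where "y = \<psi> \<epsilon> \<epsilon>"
  define g where "g a b = \<psi> (of_bool a * \<epsilon>) (of_bool b * \<epsilon>)" for a b
  \<comment> \<open>A leaf consistent with Bob's input only contributes a factor that ignores the
    sign of his coefficient, hence the same one to both products.\<close>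
  have \<psi>0: "\<psi> 0 (-b) = \<psi> 0 b" for b using \<psi>_minus[of 0 b] by simp
  have "spin w * balance js * (x - y) * t ^ length js \<le> spin w *
    ((\<Prod>(a, b, v)\<leftarrow>js. if a \<and> b then if v then x else y else g a b) -
     (\<Prod>(a, b, v)\<leftarrow>js. if a \<and> b then if v then y else x else g a b))"
  proof (rule product_difference_lower_bound)
    show "y \<le> x" using \<tau> \<tau>_eq by (simp add: x_def y_def \<tau>_def)
  qed (use t \<epsilon> nonneg cos_ge in \<open>auto simp: y_def g_def \<psi>_def\<close>)
  also have "(\<Prod>(a, b, v)\<leftarrow>js. if a \<and> b then if v then x else y else g a b) =
     measure_pmf.expectation ?R (\<lambda>zs. cos (A (map fst zs) + (-1) * B (map snd zs)))"
    unfolding E_cos by (intro arg_cong[where f=prod_list] map_cong) (auto simp: x_def y_def g_def spin_def \<psi>0)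
  also have "(\<Prod>(a, b, v)\<leftarrow>js. if a \<and> b then if v then y else x else g a b) =
     measure_pmf.expectation ?R (\<lambda>zs. cos (A (map fst zs) + 1 * B (map snd zs)))"
    unfolding E_cos by (intro arg_cong[where f=prod_list] map_cong) (auto simp: x_def y_def g_def spin_def \<psi>0)
  also have "measure_pmf.expectation ?R (\<lambda>zs. cos (A (map fst zs) + (-1) * B (map snd zs))) -
     measure_pmf.expectation ?R (\<lambda>zs. cos (A (map fst zs) + 1 * B (map snd zs))) =
     measure_pmf.expectation ?R (\<lambda>zs. 2 * (sin (A (map fst zs)) * sin (B (map snd zs))))"
    by (subst Bochner_Integration.integral_diff[OF IR IR, symmetric]) (simp add: cos_add cos_diff mult_ac)
  also have "\<dots> = 2 * measure_pmf.expectation ?R (\<lambda>zs. sin (A (map fst zs)) * sin (B (map snd zs)))"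
    by simp
  also have "x - y = 2 * \<tau>" using \<tau>_eq by (simp add: x_def y_def)
  finally show ?thesis by (simp add: \<tau>_def mult_ac)
qed

section \<open>Leaves of protocol trees as rectangles\<close>

text \<open>The rectangle is stored as one predicate per player, so that each player can test
  consistency alone.\<close>

primrec leaves :: "('x, 'y) protocol \<Rightarrow> (('x \<Rightarrow> bool) \<times> ('y \<Rightarrow> bool) \<times> bool) list" where
  "leaves (Answer v) = [(\<lambda>_. True, \<lambda>_. True, v)]"
| "leaves (Alice q l r) =
     map (\<lambda>(a, b, v). (\<lambda>x. \<not> q x \<and> a x, b, v)) (leaves l) @
     map (\<lambda>(a, b, v). (\<lambda>x. q x \<and> a x, b, v)) (leaves r)"
| "leaves (Bob q l r) =
     map (\<lambda>(a, b, v). (a, \<lambda>y. \<not> q y \<and> b y, v)) (leaves l) @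
     map (\<lambda>(a, b, v). (a, \<lambda>y. q y \<and> b y, v)) (leaves r)"

definition at_input :: "'x \<Rightarrow> 'y \<Rightarrow> ('x \<Rightarrow> bool) \<times> ('y \<Rightarrow> bool) \<times> bool \<Rightarrow> bool \<times> bool \<times> bool" where
  "at_input x y = (\<lambda>(a, b, v). (a x, b y, v))"

lemma balance_append [simp]: "balance (js @ ks) = balance js + balance ks"
  by (simp add: balance_def)

text \<open>The rectangles partition the inputs: exactly one leaf is consistent with both
  \<open>x\<close> and \<open>y\<close>, and it carries the answer of the run.\<close>

lemma balance_leaves: "balance (map (at_input x y) (leaves t)) = spin (run t x y)"
proof (induction t)
  case (Alice q l r)
  then show ?case
    by (cases "q x") (simp_all add: balance_def at_input_def o_def case_prod_unfold)
next
  case (Bob q l r)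
  then show ?case
    by (cases "q y") (simp_all add: balance_def at_input_def o_def case_prod_unfold)
qed (simp add: balance_def at_input_def)

lemma length_leaves: "length (leaves t) \<le> 2 ^ height t"
proof (induction t)
  case (Alice q l r)
  have "(2::nat) ^ height l \<le> 2 ^ max (height l) (height r)" "(2::nat) ^ height r \<le> 2 ^ max (height l) (height r)"
    by (auto intro!: power_increasing)
  then show ?case using Alice unfolding leaves.simps height.simps length_append length_map power_Suc by linarith
next
  case (Bob q l r)
  have "(2::nat) ^ height l \<le> 2 ^ max (height l) (height r)" "(2::nat) ^ height r \<le> 2 ^ max (height l) (height r)"
    by (auto intro!: power_increasing)
  then show ?case using Bob unfolding leaves.simps height.simps length_append length_map power_Suc by linarith
qed simp

section \<open>Replacing the public coin by a finite list of protocols\<close>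

text \<open>The support of a \<open>pmf\<close> is countable, so initial segments of an enumeration
  exhaust it. This allows public coins of infinite support.\<close>

lemma finite_prob_approx:
  fixes p :: "'a pmf"
  assumes "0 < \<eta>"
  shows "\<exists>A. finite A \<and> A \<subseteq> set_pmf p \<and> 1 - \<eta> < measure_pmf.prob p A"
proof -
  define A where "A n = from_nat_into (set_pmf p) ` {..<n::nat}" for n
  have inc: "incseq A" by (auto simp: incseq_def A_def)
  have "(\<Union>n. A n) = set_pmf p"
  proof -
    have "(\<Union>n. A n) = range (from_nat_into (set_pmf p))" by (auto simp: A_def)
    then show ?thesis by (simp add: range_from_nat_into set_pmf_not_empty)
  qed
  moreover have "measure_pmf.prob p (set_pmf p) = 1"
    by (rule measure_pmf.prob_eq_1[THEN iffD2]) (auto simp: AE_measure_pmf)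
  ultimately have "(\<lambda>n. measure_pmf.prob p (A n)) \<longlonglongrightarrow> 1"
    using measure_pmf.finite_Lim_measure_incseq[OF _ inc, of p] by simp
  then have "\<forall>\<^sub>F n in sequentially. 1 - \<eta> < measure_pmf.prob p (A n)"
    using assms by (intro order_tendstoD) auto
  then obtain n where "1 - \<eta> < measure_pmf.prob p (A n)"
    using eventually_happens by force
  moreover have "A n \<subseteq> set_pmf p" by (auto simp: A_def from_nat_into set_pmf_not_empty)
  ultimately show ?thesis by (intro exI[of _ "A n"]) (auto simp: A_def)
qed

text \<open>The list is obtained by rounding frequencies, not by sampling, so the bound is uniform
  over arbitrarily many inputs. The length \<open>R\<close> may be any large number, which later
  permits a small \<open>\<epsilon>\<close>.\<close>

lemma empirical_protocols:
  fixes f :: "'x \<times> 'y \<rightharpoonup> bool"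
  assumes "public_coin_computes (1/3) f P"
  shows "\<exists>R0. \<forall>R\<ge>R0. \<exists>ts. set ts \<subseteq> set_pmf P \<and> length ts \<le> R \<and>
    (\<forall>x y v. f (x, y) = Some v \<longrightarrow> real R / 4 \<le> (\<Sum>t\<leftarrow>ts. spin (run t x y = v)))"
proof -
  \<comment> \<open>Budget in units of 1/24: \<open>A\<close> has mass at least 23, of which at most
    8 is wrong, so right exceeds wrong by at least 7; rounding costs at most 1 since
    \<open>24 * card A \<le> R\<close>. What is left is 6, that is 1/4.\<close>
  obtain A where A: "finite A" "A \<subseteq> set_pmf P" "1 - 1/24 < measure_pmf.prob P A"
    using finite_prob_approx[of "1/24" P] by auto
  show ?thesis
  proof (intro exI[of _ "24 * card A"] allI impI)
    fix R assume R: "24 * card A \<le> R"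
    define k where "k t = nat \<lfloor>pmf P t * R\<rfloor>" for t
    have k: "real (k t) \<le> pmf P t * R" "pmf P t * R - 1 \<le> real (k t)" for t
      by (simp_all add: k_def)
    obtain xs where xs: "set xs = A" "distinct xs" using finite_distinct_list[OF A(1)] by blast
    define ts where "ts = concat (map (\<lambda>t. replicate (k t) t) xs)"
    have sum_ts: "(\<Sum>t\<leftarrow>ts. h t) = (\<Sum>t\<in>A. real (k t) * h t)" for h :: "_ \<Rightarrow> real"
    proof -
      have "(\<Sum>t\<leftarrow>ts. h t) = (\<Sum>t\<leftarrow>xs. real (k t) * h t)"
        unfolding ts_def by (induction xs) (simp_all add: sum_list_replicate)
      then show ?thesis using xs by (simp add: sum_list_distinct_conv_sum_set)
    qed
    have probA: "measure_pmf.prob P B = (\<Sum>t\<in>B. pmf P t)" if "B \<subseteq> A" for B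
      using that A(1) by (intro measure_measure_pmf_finite) (auto intro: finite_subset)
    have len: "length ts \<le> R"
    proof -
      have "real (length ts) = (\<Sum>t\<leftarrow>ts. 1)" by (simp add: sum_list_triv)
      also have "\<dots> = (\<Sum>t\<in>A. real (k t))" unfolding sum_ts by simp
      also have "\<dots> \<le> (\<Sum>t\<in>A. pmf P t * R)" by (intro sum_mono k)
      also have "\<dots> = measure_pmf.prob P A * R" by (simp add: probA sum_distrib_right)
      also have "\<dots> \<le> 1 * real R" by (intro mult_right_mono) auto
      finally show ?thesis by simp
    qed
    have "real R / 4 \<le> (\<Sum>t\<leftarrow>ts. spin (run t x y = v))" if f: "f (x, y) = Some v" for x y v
    proof -
      define good where "good = {t. run t x y = v}"
      have good: "2/3 \<le> measure_pmf.prob P good"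
        using assms f by (auto simp: public_coin_computes_def good_def)
      have "measure_pmf.prob P (- good) \<le> 1/3"
        using good measure_pmf.prob_compl[of good P] by (simp add: Compl_eq_Diff_UNIV)
      then have bad: "measure_pmf.prob P (A - good) \<le> 1/3"
        using measure_pmf.finite_measure_mono[of "A - good" "- good" P] by fastforce
      have "measure_pmf.prob P (A \<inter> good) + measure_pmf.prob P (A - good) = measure_pmf.prob P A"
        by (subst measure_pmf.finite_measure_Union[symmetric])
          (auto intro!: arg_cong[where f="measure_pmf.prob P"])
      then have diff: "measure_pmf.prob P (A \<inter> good) - measure_pmf.prob P (A - good) \<ge> 7/24"
        using bad A(3) by linarith
      have "real R / 4 \<le> 7/24 * R - card A" using R by simp
      also have "\<dots> \<le> (measure_pmf.prob P (A \<inter> good) - measure_pmf.prob P (A - good)) * R - card A"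
        using diff by (intro diff_right_mono mult_right_mono) auto
      also have "measure_pmf.prob P (A \<inter> good) - measure_pmf.prob P (A - good) =
          (\<Sum>t\<in>A. pmf P t * spin (run t x y = v))"
      proof -
        have "(\<Sum>t\<in>A. pmf P t * spin (run t x y = v)) =
          (\<Sum>t\<in>A \<inter> good. pmf P t * spin (run t x y = v)) + (\<Sum>t\<in>A - good. pmf P t * spin (run t x y = v))"
          using A(1) by (rule sum.Int_Diff)
        also have "(\<Sum>t\<in>A \<inter> good. pmf P t * spin (run t x y = v)) = (\<Sum>t\<in>A \<inter> good. pmf P t)"
          by (intro sum.cong) (auto simp: good_def spin_def)
        also have "(\<Sum>t\<in>A - good. pmf P t * spin (run t x y = v)) = (\<Sum>t\<in>A - good. - pmf P t)"
          by (intro sum.cong) (auto simp: good_def spin_def)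
        finally show ?thesis by (simp add: probA sum_negf)
      qed
      also have "(\<Sum>t\<in>A. pmf P t * spin (run t x y = v)) * R - card A =
          (\<Sum>t\<in>A. pmf P t * R * spin (run t x y = v) - 1)"
        by (simp add: sum_subtractf sum_distrib_left mult_ac)
      also have "\<dots> \<le> (\<Sum>t\<in>A. real (k t) * spin (run t x y = v))"
      proof (intro sum_mono)
        fix t
        \<comment> \<open>Rounding down loses at most 1 on a correct protocol and can only help on a
          wrong one.\<close>
        show "pmf P t * R * spin (run t x y = v) - 1 \<le> real (k t) * spin (run t x y = v)"
          using k[of t] by (cases "run t x y = v") (auto simp: spin_def)
      qed
      finally show ?thesis unfolding sum_ts .
    qed
    moreover have "set ts \<subseteq> set_pmf P" using A(2) xs by (auto simp: ts_def)
    ultimately show "\<exists>ts. set ts \<subseteq> set_pmf P \<and> length ts \<le> R \<and>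
      (\<forall>x y v. f (x, y) = Some v \<longrightarrow> real R / 4 \<le> (\<Sum>t\<leftarrow>ts. spin (run t x y = v)))"
      using len by blast
  qed
qed

section \<open>Symmetrised samples\<close>

text \<open>The difference of two independent samples has a symmetric law, which makes all sine
  moments vanish; covariances and variances merely double.\<close>

definition symmetrize :: "(real \<times> real) pmf \<Rightarrow> (real \<times> real) pmf" where
  "symmetrize \<nu> = map_pmf (\<lambda>((a, b), (a', b')). (a - a', b - b')) (pair_pmf \<nu> \<nu>)"

lemma finite_set_symmetrize: "finite (set_pmf \<nu>) \<Longrightarrow> finite (set_pmf (symmetrize \<nu>))"
  by (simp add: symmetrize_def)

lemma simulates_symmetrize: "simulates \<nu> (\<lambda>_ _. symmetrize \<nu>)"
proof -
  have "symmetrize \<nu> = map_pmf (map_prod (\<lambda>(a, a'). a - a') (\<lambda>(b, b'). b - b'))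
      (map_pmf (\<lambda>((a, b), (a', b')). ((a, a'), (b, b'))) (pair_pmf \<nu> \<nu>))"
    unfolding symmetrize_def map_pmf_comp by (rule map_pmf_cong) auto
  then show ?thesis
    using simulates_map_prod[OF simulates_pair[OF simulates_self simulates_self]] by simp
qed

text \<open>Exchanging the two samples preserves their joint law and negates both differences, so
  the expectation equals its own negative.\<close>

lemma expectation_symmetrize_odd:
  fixes h :: "real \<times> real \<Rightarrow> real"
  assumes "\<And>a b. h (- a, - b) = - h (a, b)"
  shows "measure_pmf.expectation (symmetrize \<nu>) h = 0"
proof -
  have "measure_pmf.expectation (symmetrize \<nu>) h =
      measure_pmf.expectation (map_pmf (\<lambda>(x, y). (y, x)) (pair_pmf \<nu> \<nu>)) (\<lambda>((a, b), (a', b')). h (a - a', b - b'))"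
    by (subst pair_commute_pmf[symmetric]) (simp add: symmetrize_def case_prod_unfold)
  also have "\<dots> = measure_pmf.expectation (pair_pmf \<nu> \<nu>) (\<lambda>((a, b), (a', b')). - h (a - a', b - b'))"
    by (auto intro!: Bochner_Integration.integral_cong simp: case_prod_unfold simp flip: assms)
  also have "\<dots> = - measure_pmf.expectation (symmetrize \<nu>) h"
    by (simp add: symmetrize_def case_prod_unfold)
  finally show ?thesis by simp
qed

text \<open>The right-hand side is twice the covariance; at \<open>f = g\<close> it is twice the
  variance, whence the second moment bounds after symmetrisation.\<close>

lemma expectation_pair_pmf_diff_mult_diff:
  fixes f g :: "'a \<Rightarrow> real"
  assumes fin: "finite (set_pmf p)"
  shows "measure_pmf.expectation (pair_pmf p p) (\<lambda>z. (f (fst z) - f (snd z)) * (g (fst z) - g (snd z))) =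
    2 * (measure_pmf.expectation p (\<lambda>z. f z * g z) - measure_pmf.expectation p f * measure_pmf.expectation p g)"
proof -
  have I: "integrable (measure_pmf p) h" for h :: "_ \<Rightarrow> real"
    using fin by (rule integrable_measure_pmf_finite)
  have I2: "integrable (measure_pmf (pair_pmf p p)) h" for h :: "_ \<Rightarrow> real"
    using fin by (intro integrable_measure_pmf_finite) auto
  have "measure_pmf.expectation (pair_pmf p p) (\<lambda>z. (f (fst z) - f (snd z)) * (g (fst z) - g (snd z))) =
     measure_pmf.expectation (pair_pmf p p) (\<lambda>z. f (fst z) * g (fst z) + f (snd z) * g (snd z)
       - (f (fst z) * g (snd z) + g (fst z) * f (snd z)))"
    by (intro Bochner_Integration.integral_cong) (auto simp: algebra_simps)
  also have "\<dots> = measure_pmf.expectation p (\<lambda>z. f z * g z) + measure_pmf.expectation p (\<lambda>z. f z * g z)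
     - (measure_pmf.expectation p f * measure_pmf.expectation p g + measure_pmf.expectation p g * measure_pmf.expectation p f)"
    using expectation_pair_pmf_fst[of p p "\<lambda>z. f z * g z"] expectation_pair_pmf_snd[of p p "\<lambda>z. f z * g z"]
    by (simp add: I2 expectation_pair_pmf_mult[OF fin fin])
  finally show ?thesis by simp
qed

lemma expectation_symmetrize_mult:
  assumes "finite (set_pmf \<nu>)"
  shows "measure_pmf.expectation (symmetrize \<nu>) (\<lambda>z. fst z * snd z) =
      2 * (measure_pmf.expectation \<nu> (\<lambda>z. fst z * snd z) - measure_pmf.expectation \<nu> fst * measure_pmf.expectation \<nu> snd)"
    and "measure_pmf.expectation (symmetrize \<nu>) (\<lambda>z. (fst z)\<^sup>2) \<le> 2 * measure_pmf.expectation \<nu> (\<lambda>z. (fst z)\<^sup>2)"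
    and "measure_pmf.expectation (symmetrize \<nu>) (\<lambda>z. (snd z)\<^sup>2) \<le> 2 * measure_pmf.expectation \<nu> (\<lambda>z. (snd z)\<^sup>2)"
  using expectation_pair_pmf_diff_mult_diff[OF assms, of fst snd]
    expectation_pair_pmf_diff_mult_diff[OF assms, of fst fst]
    expectation_pair_pmf_diff_mult_diff[OF assms, of snd snd]
  by (simp_all add: symmetrize_def case_prod_unfold power2_eq_square)

section \<open>Estimates for small angles\<close>

lemma cos_ge_quadratic: "1 - x\<^sup>2 / 2 \<le> cos (x::real)"
proof -
  have "cos x = 1 - 2 * (sin (x / 2))\<^sup>2"
    using cos_double_sin[of "x / 2"] by simp
  moreover have "(sin (x / 2))\<^sup>2 \<le> (x / 2)\<^sup>2"
    using abs_sin_x_le_abs_x[of "x / 2"] by (simp only: abs_le_square_iff)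
  ultimately show ?thesis by (simp add: power_divide)
qed

text \<open>The quadratic bound on the cosine, combined with
  \<open>(u + v)\<^sup>2 \<le> 2 * (u\<^sup>2 + v\<^sup>2)\<close>, needs second moments only and no
  information on the mixed moment.\<close>

lemma expectation_cos_ge:
  fixes p :: "(real \<times> real) pmf"
  assumes fin: "finite (set_pmf p)"
    and X: "measure_pmf.expectation p (\<lambda>z. (fst z)\<^sup>2) \<le> s"
    and Y: "measure_pmf.expectation p (\<lambda>z. (snd z)\<^sup>2) \<le> s"
    and ab: "\<bar>a\<bar> \<le> \<epsilon>" "\<bar>b\<bar> \<le> \<epsilon>"
  shows "1 - 2 * s * \<epsilon>\<^sup>2 \<le> measure_pmf.expectation p (\<lambda>z. cos (a * fst z + b * snd z))"
proof -
  have I: "integrable (measure_pmf p) h" for h :: "_ \<Rightarrow> real"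
    using fin by (rule integrable_measure_pmf_finite)
  have sq: "a\<^sup>2 \<le> \<epsilon>\<^sup>2" "b\<^sup>2 \<le> \<epsilon>\<^sup>2" using ab by (metis abs_ge_zero power2_abs power_mono)+
  have "a\<^sup>2 * measure_pmf.expectation p (\<lambda>z. (fst z)\<^sup>2) \<le> \<epsilon>\<^sup>2 * s"
    using sq X by (intro mult_mono) (auto intro: Bochner_Integration.integral_nonneg)
  moreover have "b\<^sup>2 * measure_pmf.expectation p (\<lambda>z. (snd z)\<^sup>2) \<le> \<epsilon>\<^sup>2 * s"
    using sq Y by (intro mult_mono) (auto intro: Bochner_Integration.integral_nonneg)
  ultimately have "1 - 2 * s * \<epsilon>\<^sup>2 \<le> 1 - (a\<^sup>2 * measure_pmf.expectation p (\<lambda>z. (fst z)\<^sup>2)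
      + b\<^sup>2 * measure_pmf.expectation p (\<lambda>z. (snd z)\<^sup>2))"
    by (simp add: mult_ac)
  also have "\<dots> = measure_pmf.expectation p (\<lambda>z. 1 - (a\<^sup>2 * (fst z)\<^sup>2 + b\<^sup>2 * (snd z)\<^sup>2))"
    by (simp add: I)
  also have "\<dots> \<le> measure_pmf.expectation p (\<lambda>z. cos (a * fst z + b * snd z))"
  proof (intro integral_mono I)
    fix z :: "real \<times> real"
    have le: "1 - m \<le> c" if "1 - q / 2 \<le> c" "q \<le> 2 * m" for q m c :: real
      using that by linarith
    have "(a * fst z + b * snd z)\<^sup>2 \<le> 2 * (a\<^sup>2 * (fst z)\<^sup>2 + b\<^sup>2 * (snd z)\<^sup>2)"
      using zero_le_power2[of "a * fst z - b * snd z"] by (simp add: power2_eq_square algebra_simps)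
    then show "1 - (a\<^sup>2 * (fst z)\<^sup>2 + b\<^sup>2 * (snd z)\<^sup>2) \<le> cos (a * fst z + b * snd z)"
      by (rule le[OF cos_ge_quadratic])
  qed
  finally show ?thesis .
qed

text \<open>To leading order the expectation is \<open>\<epsilon>\<^sup>2\<close> times the mixed
  moment. Finite support lets the limit pass through the sum, and the strict inequality absorbs the
  remainder.\<close>

lemma expectation_sin_mult_sin_ge:
  fixes p :: "(real \<times> real) pmf"
  assumes fin: "finite (set_pmf p)" and k: "k < measure_pmf.expectation p (\<lambda>z. fst z * snd z)"
  shows "\<exists>\<epsilon>0>0. \<forall>\<epsilon>. 0 < \<epsilon> \<longrightarrow> \<epsilon> < \<epsilon>0 \<longrightarrow>
    k * \<epsilon>\<^sup>2 \<le> measure_pmf.expectation p (\<lambda>z. sin (\<epsilon> * fst z) * sin (\<epsilon> * snd z))"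
proof -
  have lim: "((\<lambda>\<epsilon>. sin (\<epsilon> * x) / \<epsilon>) \<longlongrightarrow> x) (at_right 0)" for x :: real
  proof -
    have "((\<lambda>\<epsilon>. sin (\<epsilon> * x)) has_real_derivative x) (at_right 0)"
      by (auto intro!: derivative_eq_intros)
    then show ?thesis by (simp add: has_field_derivative_iff)
  qed
  have E: "measure_pmf.expectation p h = (\<Sum>z\<in>set_pmf p. h z * pmf p z)" for h :: "_ \<Rightarrow> real"
    using fin by (intro integral_measure_pmf_real) auto
  have "((\<lambda>\<epsilon>. \<Sum>z\<in>set_pmf p. (sin (\<epsilon> * fst z) / \<epsilon>) * (sin (\<epsilon> * snd z) / \<epsilon>) * pmf p z) \<longlongrightarrow>
      (\<Sum>z\<in>set_pmf p. (fst z * snd z) * pmf p z)) (at_right 0)"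
    by (intro tendsto_intros lim)
  then have "\<forall>\<^sub>F \<epsilon> in at_right 0. k < (\<Sum>z\<in>set_pmf p. (sin (\<epsilon> * fst z) / \<epsilon>) * (sin (\<epsilon> * snd z) / \<epsilon>) * pmf p z)"
    using k unfolding E by (intro order_tendstoD)
  then obtain \<epsilon>0 where \<epsilon>0: "0 < \<epsilon>0" "\<And>\<epsilon>. 0 < \<epsilon> \<Longrightarrow> \<epsilon> < \<epsilon>0 \<Longrightarrow>
      k < (\<Sum>z\<in>set_pmf p. (sin (\<epsilon> * fst z) / \<epsilon>) * (sin (\<epsilon> * snd z) / \<epsilon>) * pmf p z)"
    unfolding eventually_at_right_field by auto
  have "k * \<epsilon>\<^sup>2 \<le> measure_pmf.expectation p (\<lambda>z. sin (\<epsilon> * fst z) * sin (\<epsilon> * snd z))" if "0 < \<epsilon>" "\<epsilon> < \<epsilon>0" for \<epsilon>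
  proof -
    have "k * \<epsilon>\<^sup>2 \<le> (\<Sum>z\<in>set_pmf p. (sin (\<epsilon> * fst z) / \<epsilon>) * (sin (\<epsilon> * snd z) / \<epsilon>) * pmf p z) * \<epsilon>\<^sup>2"
      using \<epsilon>0(2)[OF that] by (intro mult_right_mono) auto
    also have "\<dots> = measure_pmf.expectation p (\<lambda>z. sin (\<epsilon> * fst z) * sin (\<epsilon> * snd z))"
      unfolding E sum_distrib_right using that by (intro sum.cong) (auto simp: power2_eq_square)
    finally show ?thesis .
  qed
  then show ?thesis using \<epsilon>0(1) by blast
qed

section \<open>Rounding bounded reals to bits\<close>

lemma map_replicate_pmf: "map_pmf (map g) (replicate_pmf n p) = replicate_pmf n (map_pmf g p)"
proof (induction n)
  case (Suc n)
  show ?case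
    unfolding replicate_pmf.simps Suc.IH[symmetric] by (simp add: map_bind_pmf bind_map_pmf)
qed simp

text \<open>Given the two reals, the rounded bits are independent with means close to them, so the
  mean product of the signs is close to the product of the reals.\<close>

lemma simulates_round:
  fixes \<nu> :: "('s \<times> 't) pmf" and K :: "'x \<Rightarrow> 'y \<Rightarrow> (real \<times> real) pmf"
  assumes fin: "finite (set_pmf \<nu>)"
    and s: "s1 \<in> fst ` set_pmf \<nu>" "s2 \<in> fst ` set_pmf \<nu>" "s1 \<noteq> s2"
    and t: "t1 \<in> snd ` set_pmf \<nu>" "t2 \<in> snd ` set_pmf \<nu>" "t1 \<noteq> t2"
    and K: "simulates \<nu> K" and bounded: "\<And>x y z. z \<in> set_pmf (K x y) \<Longrightarrow> \<bar>fst z\<bar> \<le> 1 \<and> \<bar>snd z\<bar> \<le> 1"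
    and \<eta>: "0 < \<eta>" "\<eta> \<le> 1"
  shows "\<exists>D :: 'x \<Rightarrow> 'y \<Rightarrow> (bool \<times> bool) pmf. simulates \<nu> D \<and> (\<forall>x y. \<bar>measure_pmf.expectation (D x y) (\<lambda>(a, b). spin (a = b)) -
      measure_pmf.expectation (K x y) (\<lambda>z. fst z * snd z)\<bar> \<le> 3 * \<eta>)"
proof -
  obtain n W where "\<forall>u. \<bar>u\<bar> \<le> 1 \<longrightarrow>
      \<bar>measure_pmf.expectation (replicate_pmf n (map_pmf fst \<nu>)) (\<lambda>zs. spin (zs \<in> W u)) - u\<bar> \<le> \<eta>"
    using ex_randomized_rounding[of "map_pmf fst \<nu>" s1 s2 \<eta>] fin s \<eta> by auto
  then have W: "\<bar>measure_pmf.expectation (replicate_pmf n \<nu>) (\<lambda>zs. spin (map fst zs \<in> W u)) - u\<bar> \<le> \<eta>"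
    if "\<bar>u\<bar> \<le> 1" for u
    using that by (simp flip: map_replicate_pmf)
  obtain n' W' where "\<forall>u. \<bar>u\<bar> \<le> 1 \<longrightarrow>
      \<bar>measure_pmf.expectation (replicate_pmf n' (map_pmf snd \<nu>)) (\<lambda>zs. spin (zs \<in> W' u)) - u\<bar> \<le> \<eta>"
    using ex_randomized_rounding[of "map_pmf snd \<nu>" t1 t2 \<eta>] fin t \<eta> by auto
  then have W': "\<bar>measure_pmf.expectation (replicate_pmf n' \<nu>) (\<lambda>zs. spin (map snd zs \<in> W' u)) - u\<bar> \<le> \<eta>"
    if "\<bar>u\<bar> \<le> 1" for u
    using that by (simp flip: map_replicate_pmf)
  define r where "r u = measure_pmf.expectation (replicate_pmf n \<nu>) (\<lambda>zs. spin (map fst zs \<in> W u))" for u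
  define r' where "r' u = measure_pmf.expectation (replicate_pmf n' \<nu>) (\<lambda>zs. spin (map snd zs \<in> W' u))" for u
  define L where "L k = map_pmf (\<lambda>zs. (map fst zs, map snd zs)) (replicate_pmf k \<nu>)" for k
  \<comment> \<open>Alice rounds with her half of the first block, Bob with his half of the second.
    Using different blocks keeps the two roundings independent although the halves of one sample are
    correlated.\<close>
  define D where "D x y = map_pmf (map_prod (\<lambda>(u, as, as'). as \<in> W u) (\<lambda>(w, bs, bs'). bs' \<in> W' w))
      (map_pmf (\<lambda>((a, b), (a', b')). ((a, a'), (b, b'))) (pair_pmf (K x y)
        (map_pmf (\<lambda>((a, b), (a', b')). ((a, a'), (b, b'))) (pair_pmf (L n) (L n')))))" for x y
  have "simulates \<nu> D"
    unfolding D_def L_def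
    by (intro simulates_map_prod simulates_pair K simulates_replicate simulates_self)
  moreover have "\<bar>measure_pmf.expectation (D x y) (\<lambda>(a, b). spin (a = b)) -
      measure_pmf.expectation (K x y) (\<lambda>z. fst z * snd z)\<bar> \<le> 3 * \<eta>" for x y
  proof -
    have finK: "finite (set_pmf (K x y))" by (rule finite_set_pmf_simulates[OF K fin])
    have finL: "finite (set_pmf (L k))" for k
      unfolding L_def using finite_set_replicate_pmf[OF fin] by simp
    have I: "integrable (measure_pmf (K x y)) h" for h :: "_ \<Rightarrow> real"
      using finK by (rule integrable_measure_pmf_finite)
    have "measure_pmf.expectation (D x y) (\<lambda>(a, b). spin (a = b)) =
      measure_pmf.expectation (pair_pmf (K x y) (pair_pmf (L n) (L n')))
        (\<lambda>(k, l, l'). spin (fst l \<in> W (fst k)) * spin (snd l' \<in> W' (snd k)))"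
      by (simp add: D_def case_prod_unfold spin_mult pair_map_pmf2)
    also have "\<dots> = measure_pmf.expectation (K x y) (\<lambda>k. r (fst k) * r' (snd k))"
      using finK finL
      by (simp add: expectation_pair_pmf_finite) (simp add: L_def r_def r'_def)
    finally have "\<bar>measure_pmf.expectation (D x y) (\<lambda>(a, b). spin (a = b)) -
        measure_pmf.expectation (K x y) (\<lambda>z. fst z * snd z)\<bar> =
      \<bar>measure_pmf.expectation (K x y) (\<lambda>k. r (fst k) * r' (snd k) - fst k * snd k)\<bar>"
      by (simp add: I)
    also have "\<dots> \<le> measure_pmf.expectation (K x y) (\<lambda>k. \<bar>r (fst k) * r' (snd k) - fst k * snd k\<bar>)"
      by (rule integral_abs_bound)
    also have "\<dots> \<le> measure_pmf.expectation (K x y) (\<lambda>k. 3 * \<eta>)"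
    proof (rule integral_mono_AE[OF I I], rule AE_pmfI)
      fix k assume "k \<in> set_pmf (K x y)"
      then have k: "\<bar>fst k\<bar> \<le> 1" "\<bar>snd k\<bar> \<le> 1" using bounded by auto
      have r: "\<bar>r (fst k) - fst k\<bar> \<le> \<eta>" "\<bar>r' (snd k) - snd k\<bar> \<le> \<eta>"
        using W W' k by (auto simp: r_def r'_def)
      then have "\<bar>r (fst k)\<bar> \<le> 2" using k \<eta> by linarith
      \<comment> \<open>One factor is replaced at a time; the replacements cost
        \<open>2 * \<eta>\<close> and \<open>\<eta>\<close>.\<close>
      have "r (fst k) * r' (snd k) - fst k * snd k =
          r (fst k) * (r' (snd k) - snd k) + (r (fst k) - fst k) * snd k"
        by (simp add: algebra_simps)
      then have "\<bar>r (fst k) * r' (snd k) - fst k * snd k\<bar> \<le>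
          \<bar>r (fst k)\<bar> * \<bar>r' (snd k) - snd k\<bar> + \<bar>r (fst k) - fst k\<bar> * \<bar>snd k\<bar>"
        by (metis abs_mult abs_triangle_ineq)
      also have "\<dots> \<le> 2 * \<eta> + \<eta> * 1"
        using \<open>\<bar>r (fst k)\<bar> \<le> 2\<close> r k \<eta> by (intro add_mono mult_mono) auto
      finally show "\<bar>r (fst k) * r' (snd k) - fst k * snd k\<bar> \<le> 3 * \<eta>" by simp
    qed
    finally show ?thesis by simp
  qed
  ultimately show ?thesis by blast
qed

subsection \<open>Correlated bits from a public-coin protocol\<close>

text \<open>Every protocol of the list votes once, through its one consistent leaf;
  \<open>spin v\<close> turns the vote into correct minus wrong answers.\<close>

lemma balance_concat_leaves:
  "spin v * balance (map (at_input x y) (concat (map leaves ts))) = (\<Sum>t\<leftarrow>ts. spin (run t x y = v))"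
proof -
  have "balance (map (at_input x y) (concat (map leaves ts))) = (\<Sum>t\<leftarrow>ts. spin (run t x y))"
    by (induction ts) (simp_all add: balance_leaves, simp add: balance_def)
  moreover have "spin v * spin b = spin (b = v)" for b
    by (simp add: spin_def)
  ultimately show ?thesis
    by (simp only: sum_list_const_mult[symmetric])
qed

text \<open>A constant has zero covariance with everything. The two distinct values supply the
  nontrivial event that randomised rounding starts from.\<close>

lemma covariance_pos_imp_nonconstant:
  fixes F G :: "'a \<Rightarrow> real"
  assumes "finite (set_pmf p)"
    and "measure_pmf.expectation p F * measure_pmf.expectation p G < measure_pmf.expectation p (\<lambda>z. F z * G z)"
  shows "\<exists>s1\<in>F ` set_pmf p. \<exists>s2\<in>F ` set_pmf p. s1 \<noteq> s2"
proof (rule ccontr)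
  assume *: "\<not> ?thesis"
  obtain z0 where "z0 \<in> set_pmf p" using set_pmf_not_empty[of p] by blast
  with * have const: "AE z in measure_pmf p. F z = F z0" by (intro AE_pmfI) blast
  have "measure_pmf.expectation p F = measure_pmf.expectation p (\<lambda>_. F z0)"
    using const by (intro integral_cong_AE) auto
  moreover have "measure_pmf.expectation p (\<lambda>z. F z * G z) = measure_pmf.expectation p (\<lambda>z. F z0 * G z)"
    using const by (intro integral_cong_AE) auto
  ultimately show False using assms(2) by simp
qed

text \<open>The advantage does not depend on the length \<open>R\<close> of the list: the vote grows
  like \<open>R\<close>, while the correlation gained per leaf shrinks like
  \<open>\<epsilon>\<^sup>2\<close>, that is like \<open>1 / R\<close>.\<close>

lemma correlated_bits:
  fixes \<nu> :: "(real \<times> real) pmf" and f :: "'x \<times> 'y \<rightharpoonup> bool" and \<rho> :: real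
  assumes fin: "finite (set_pmf \<nu>)"
    and X: "measure_pmf.expectation \<nu> (\<lambda>z. (fst z)\<^sup>2) \<le> 9/8"
    and Y: "measure_pmf.expectation \<nu> (\<lambda>z. (snd z)\<^sup>2) \<le> 9/8"
    and cov: "3/4 * \<rho> \<le> measure_pmf.expectation \<nu> (\<lambda>z. fst z * snd z) -
        measure_pmf.expectation \<nu> fst * measure_pmf.expectation \<nu> snd"
    and \<rho>: "0 < \<rho>" "\<rho> \<le> 1"
    and computes: "public_coin_computes (1/3) f P" and height: "\<And>t. t \<in> set_pmf P \<Longrightarrow> height t \<le> c"
  shows "\<exists>D :: 'x \<Rightarrow> 'y \<Rightarrow> (bool \<times> bool) pmf. simulates \<nu> D \<and> (\<forall>x y v. f (x, y) = Some v \<longrightarrow>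
      \<rho> / (128 * 2 ^ c) \<le> measure_pmf.expectation (D x y) (\<lambda>(a, b). spin ((a = b) = v)))"
proof -
  define p where "p = symmetrize \<nu>"
  have finp: "finite (set_pmf p)" using fin by (simp add: p_def finite_set_symmetrize)
  have X2: "measure_pmf.expectation p (\<lambda>z. (fst z)\<^sup>2) \<le> 9/4"
    and Y2: "measure_pmf.expectation p (\<lambda>z. (snd z)\<^sup>2) \<le> 9/4"
    using expectation_symmetrize_mult(2,3)[OF fin] X Y by (auto simp: p_def)
  \<comment> \<open>Symmetrisation doubles the covariance to at least \<open>3/2 * \<rho>\<close>,
    leaving strict room above \<open>\<rho>\<close>.\<close>
  have "\<rho> < measure_pmf.expectation p (\<lambda>z. fst z * snd z)"
    unfolding p_def expectation_symmetrize_mult(1)[OF fin]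
    by (rule less_le_trans[of _ "2 * (3/4 * \<rho>)"]) (use cov \<rho> in auto)
  from expectation_sin_mult_sin_ge[OF finp this] obtain \<epsilon>0 where \<epsilon>0: "0 < \<epsilon>0"
    "\<And>\<epsilon>. 0 < \<epsilon> \<Longrightarrow> \<epsilon> < \<epsilon>0 \<Longrightarrow> \<rho> * \<epsilon>\<^sup>2 \<le> measure_pmf.expectation p (\<lambda>z. sin (\<epsilon> * fst z) * sin (\<epsilon> * snd z))"
    by blast
  obtain R0 where R0: "\<forall>R\<ge>R0. \<exists>ts. set ts \<subseteq> set_pmf P \<and> length ts \<le> R \<and>
    (\<forall>x y v. f (x, y) = Some v \<longrightarrow> real R / 4 \<le> (\<Sum>t\<leftarrow>ts. spin (run t x y = v)))"
    using empirical_protocols[OF computes] by blast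
  obtain R1 :: nat where R1: "1 / \<epsilon>0\<^sup>2 < real R1" using reals_Archimedean2 by blast
  \<comment> \<open>Large enough both for the list to exist and for the resulting
    \<open>\<epsilon>\<close> to lie below \<open>\<epsilon>0\<close>.\<close>
  define R where "R = max R0 (max R1 1)"
  have R: "R0 \<le> R" "1 / \<epsilon>0\<^sup>2 < real R" "1 \<le> R" using R1 by (auto simp: R_def)
  obtain ts where ts: "set ts \<subseteq> set_pmf P" "length ts \<le> R"
    "\<And>x y v. f (x, y) = Some v \<Longrightarrow> real R / 4 \<le> (\<Sum>t\<leftarrow>ts. spin (run t x y = v))"
    using R0 R(1) by blast
  define Ls where "Ls = concat (map leaves ts)"
  have len: "real (length Ls) \<le> R * 2 ^ c"
  proof -
    have "length (leaves t) \<le> 2 ^ c" if "t \<in> set ts" for t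
      using length_leaves[of t] height[of t] ts(1) that
      by (meson le_trans one_le_numeral power_increasing subsetD)
    then have "length Ls \<le> length ts * 2 ^ c"
      unfolding Ls_def by (induction ts) (auto intro: add_mono)
    also have "\<dots> \<le> R * 2 ^ c" using ts(2) by simp
    finally show ?thesis by (metis of_nat_le_iff of_nat_mult of_nat_numeral of_nat_power)
  qed
  \<comment> \<open>There are at most \<open>R * 2 ^ c\<close> leaves, each with a cosine factor of
    at least \<open>1 - 9/2 * \<epsilon>\<^sup>2\<close>. With the constant 10, Bernoulli's
    inequality bounds their product below by \<open>1 - 9/20\<close>, hence by
    \<open>1/2\<close>.\<close>
  define \<epsilon> where "\<epsilon> = sqrt (1 / (10 * R * 2 ^ c))"
  have eps2: "\<epsilon>\<^sup>2 = 1 / (10 * R * 2 ^ c)" by (simp add: \<epsilon>_def)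
  have \<epsilon>: "0 < \<epsilon>" using R by (simp add: \<epsilon>_def)
  have "\<epsilon>\<^sup>2 \<le> 1 / R"
  proof -
    have "real R * 1 \<le> real R * (10 * 2 ^ c)" 
      using one_le_power[of "2::real" c] by (intro mult_left_mono) (auto simp del: one_le_power)
    then show ?thesis unfolding eps2 using R by (intro divide_left_mono) (auto simp: mult_ac)
  qed
  also have "\<dots> < \<epsilon>0\<^sup>2" using R \<epsilon>0(1) by (simp add: field_simps)
  finally have "\<epsilon> < \<epsilon>0" using \<epsilon>0(1) by (simp add: power_less_imp_less_base)
  with \<epsilon>0(2) \<epsilon> have \<tau>: "\<rho> * \<epsilon>\<^sup>2 \<le> measure_pmf.expectation p (\<lambda>z. sin (\<epsilon> * fst z) * sin (\<epsilon> * snd z))"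
    by blast
  define t where "t = 1 - 2 * (9/4) * \<epsilon>\<^sup>2"
  have t_small: "9/2 * \<epsilon>\<^sup>2 \<le> 1/2"
  proof -
    have "\<epsilon>\<^sup>2 \<le> 1 / 10"
      unfolding eps2 using R mult_mono[of 1 "real R" 1 "2 ^ c"] by (simp add: divide_simps)
    then show ?thesis by simp
  qed
  have t: "0 \<le> t" "t \<le> 1" using t_small by (auto simp: t_def)
  have tpow: "1/2 \<le> t ^ length Ls"
  proof -
    have "1/2 \<le> 1 + real (R * 2 ^ c) * (- (9/2 * \<epsilon>\<^sup>2))"
      unfolding eps2 using R by (simp add: field_simps)
    also have "\<dots> \<le> 1 + real (length Ls) * (- (9/2 * \<epsilon>\<^sup>2))"
      using mult_right_mono[OF len, of "9/2 * \<epsilon>\<^sup>2"] by simp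
    also have "\<dots> \<le> (1 + - (9/2 * \<epsilon>\<^sup>2)) ^ length Ls"
      using t_small by (intro Bernoulli_inequality) simp
    finally show ?thesis by (simp add: t_def)
  qed
  define A where "A x = linear_form (map (\<lambda>(a, b, v) u. of_bool (a x) * \<epsilon> * u) Ls)" for x
  define B where "B y = linear_form (map (\<lambda>(a, b, v) u. of_bool (b y) * spin v * \<epsilon> * u) Ls)" for y
  define K where "K x y = map_pmf (map_prod (\<lambda>as. sin (A x as)) (\<lambda>bs. sin (B y bs)))
      (map_pmf (\<lambda>zs. (map fst zs, map snd zs)) (replicate_pmf (length Ls) p))" for x y
  have simK: "simulates \<nu> K"
    unfolding K_def p_def by (intro simulates_map_prod simulates_replicate simulates_symmetrize)
  have K_ge: "\<rho> / (80 * 2 ^ c) \<le> spin v * measure_pmf.expectation (K x y) (\<lambda>z. fst z * snd z)"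
    if f: "f (x, y) = Some v" for x y v
  proof -
    define js where "js = map (at_input x y) Ls"
    define \<tau>' where "\<tau>' = measure_pmf.expectation p (\<lambda>z. sin (\<epsilon> * fst z) * sin (\<epsilon> * snd z))"
    have bal: "real R / 4 \<le> spin v * balance js"
      using ts(3)[OF f] by (simp add: js_def Ls_def balance_concat_leaves)
    \<comment> \<open>The three factors bound the vote, the correlation of the sines for one leaf,
      and the product of the remaining cosine factors; \<open>R\<close> cancels.\<close>
    have "\<rho> / (80 * 2 ^ c) = real R / 4 * (\<rho> * \<epsilon>\<^sup>2) * (1/2)"
      unfolding eps2 using R by simp
    also have "\<dots> \<le> spin v * balance js * \<tau>' * t ^ length js"
    proof -
      have "0 \<le> \<rho> * \<epsilon>\<^sup>2" using \<rho> by simp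
      with \<tau> have "0 \<le> \<tau>'" unfolding \<tau>'_def by (rule order_trans[rotated])
      moreover have "real R / 4 * (\<rho> * \<epsilon>\<^sup>2) * (1/2) \<le> sb * \<tau>' * t ^ length js"
        if "real R / 4 \<le> sb" for sb
      proof -
        have "0 \<le> sb" using that by (rule order_trans[rotated]) simp
        then show ?thesis
          using that \<tau> tpow \<rho> \<open>0 \<le> \<tau>'\<close>
          by (intro mult_mono mult_nonneg_nonneg) (auto simp: js_def \<tau>'_def)
      qed
      ultimately show ?thesis using bal by blast
    qed
    also have "\<dots> \<le> spin v * measure_pmf.expectation (replicate_pmf (length js) p)
       (\<lambda>zs. sin (linear_form (map (\<lambda>(a, b, v) u. of_bool a * \<epsilon> * u) js) (map fst zs)) *
             sin (linear_form (map (\<lambda>(a, b, v) u. of_bool b * spin v * \<epsilon> * u) js) (map snd zs)))"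
      unfolding \<tau>'_def
    proof (rule expectation_sin_mult_sin_lower_bound[OF finp])
      show "measure_pmf.expectation p (\<lambda>z. sin (a * fst z + b * snd z)) = 0" for a b
        unfolding p_def
        by (rule expectation_symmetrize_odd) (metis add_uminus_conv_diff fst_conv minus_add_distrib mult_minus_right sin_minus snd_conv)
      show "t \<le> measure_pmf.expectation p (\<lambda>z. cos (a * fst z + b * snd z))"
        if "\<bar>a\<bar> \<le> \<epsilon>" "\<bar>b\<bar> \<le> \<epsilon>" for a b
        unfolding t_def by (rule expectation_cos_ge[OF finp X2 Y2 that])
      show "0 \<le> measure_pmf.expectation p (\<lambda>z. sin (\<epsilon> * fst z) * sin (\<epsilon> * snd z))"
        using \<tau> \<rho> by (meson mult_nonneg_nonneg order_less_imp_le order_trans zero_le_power2)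
    qed (use t \<epsilon> bal in auto)
    also have "\<dots> = spin v * measure_pmf.expectation (K x y) (\<lambda>z. fst z * snd z)"
      by (simp add: K_def js_def A_def B_def at_input_def o_def case_prod_unfold)
    finally show ?thesis .
  qed
  have cov_pos: "measure_pmf.expectation \<nu> fst * measure_pmf.expectation \<nu> snd < measure_pmf.expectation \<nu> (\<lambda>z. fst z * snd z)"
    using cov \<rho> by linarith
  obtain s1 s2 where s: "s1 \<in> fst ` set_pmf \<nu>" "s2 \<in> fst ` set_pmf \<nu>" "s1 \<noteq> s2"
    using covariance_pos_imp_nonconstant[OF fin cov_pos] by blast
  obtain t1 t2 where t12: "t1 \<in> snd ` set_pmf \<nu>" "t2 \<in> snd ` set_pmf \<nu>" "t1 \<noteq> t2"
    using covariance_pos_imp_nonconstant[OF fin, of snd fst] cov_pos by (auto simp: mult_ac)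
  \<comment> \<open>Rounding costs \<open>3 * \<eta>\<close>, and \<open>1/80 - 3/1000\<close> still
    exceeds \<open>1/128\<close>.\<close>
  define \<eta> where "\<eta> = \<rho> / (1000 * 2 ^ c)"
  have "\<rho> \<le> 1000 * 2 ^ c"
    using \<rho>(2) one_le_power[of "2::real" c] by linarith
  then have \<eta>: "0 < \<eta>" "\<eta> \<le> 1" using \<rho> by (auto simp: \<eta>_def)
  have Kb: "\<bar>fst z\<bar> \<le> 1 \<and> \<bar>snd z\<bar> \<le> 1" if "z \<in> set_pmf (K x y)" for x y z
    using that by (auto simp: K_def)
  obtain D :: "'x \<Rightarrow> 'y \<Rightarrow> (bool \<times> bool) pmf" where D: "simulates \<nu> D"
    "\<And>x y. \<bar>measure_pmf.expectation (D x y) (\<lambda>(a, b). spin (a = b)) -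
        measure_pmf.expectation (K x y) (\<lambda>z. fst z * snd z)\<bar> \<le> 3 * \<eta>"
    using simulates_round[OF fin s t12 simK _ \<eta>] Kb by blast
  have "\<rho> / (128 * 2 ^ c) \<le> measure_pmf.expectation (D x y) (\<lambda>(a, b). spin ((a = b) = v))"
    if f: "f (x, y) = Some v" for x y v
  proof -
    let ?d = "measure_pmf.expectation (D x y) (\<lambda>(a, b). spin (a = b))"
    let ?k = "measure_pmf.expectation (K x y) (\<lambda>z. fst z * snd z)"
    have "\<rho> / (128 * 2 ^ c) \<le> \<rho> / (80 * 2 ^ c) - 3 * \<eta>"
      unfolding \<eta>_def using \<rho> by (simp add: field_simps)
    also have "\<dots> \<le> spin v * ?k - \<bar>?d - ?k\<bar>"
      using K_ge[OF f] D(2)[of x y] by linarith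
    also have "\<dots> \<le> spin v * ?d"
      by (cases v) (auto simp: spin_def)
    also have "\<dots> = measure_pmf.expectation (D x y) (\<lambda>z. spin v * spin (fst z = snd z))"
      by (simp add: case_prod_unfold)
    also have "\<dots> = measure_pmf.expectation (D x y) (\<lambda>(a, b). spin ((a = b) = v))"
      by (simp add: case_prod_unfold spin_mult eq_commute)
    finally show ?thesis .
  qed
  then show ?thesis using D(1) by blast
qed

subsection \<open>From product measures to finite distributions\<close>

text \<open>The passage from measures to \<open>pmf\<close>: a simple function has finitely many
  values, so its law is discrete.\<close>

lemma (in prob_space) simple_function_law:
  assumes h: "simple_function M h"
  shows "\<exists>\<nu>. measure_pmf \<nu> = distr M (count_space UNIV) h \<and> finite (set_pmf \<nu>)"
proof -
  have [measurable]: "h \<in> measurable M (count_space UNIV)"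
    using h by (rule measurable_simple_function)
  let ?D = "distr M (count_space UNIV) h"
  interpret D: prob_space ?D by (rule prob_space_distr) simp
  have meas: "measure ?D {v} = prob (h -` {v} \<inter> space M)" for v
    by (simp add: measure_distr)
  \<comment> \<open>A \<open>pmf\<close> must give positive mass to almost every point. The values
    of mass zero are finitely many, so together they are still null.\<close>
  define V where "V = {v \<in> h ` space M. measure ?D {v} = 0}"
  have "AE z in M. \<forall>v\<in>V. h z \<noteq> v"
  proof (subst AE_finite_all)
    show "finite V" using h by (simp add: V_def simple_function_def)
    show "\<forall>v\<in>V. AE z in M. h z \<noteq> v"
    proof
      fix v assume "v \<in> V"
      then have "prob (h -` {v} \<inter> space M) = 0" by (simp add: V_def meas)
      then show "AE z in M. h z \<noteq> v"
        by (subst (asm) prob_eq_0) (auto elim!: AE_mp)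
    qed
  qed
  then have "AE z in M. measure ?D {h z} \<noteq> 0"
    by (rule AE_mp) (auto simp: V_def)
  then have ae: "AE v in ?D. measure ?D {v} \<noteq> 0"
    by (subst AE_distr_iff) auto
  define \<nu> where "\<nu> = Abs_pmf ?D"
  have \<nu>: "measure_pmf \<nu> = ?D"
    unfolding \<nu>_def using ae D.prob_space_axioms by (intro Abs_pmf_inverse) auto
  have "set_pmf \<nu> \<subseteq> h ` space M"
  proof
    fix v assume "v \<in> set_pmf \<nu>"
    then have "measure ?D {v} \<noteq> 0"
      using \<nu> by (metis measure_pmf_single set_pmf_iff)
    then have "h -` {v} \<inter> space M \<noteq> {}" unfolding meas by force
    then show "v \<in> h ` space M" by blast
  qed
  then have "finite (set_pmf \<nu>)" using h by (auto simp: simple_function_def intro: finite_subset)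
  with \<nu> show ?thesis by blast
qed

lemma pmf_replicate_pmf:
  "pmf (replicate_pmf n p) xs = (if length xs = n then \<Prod>x\<leftarrow>xs. pmf p x else 0)"
proof (induction n arbitrary: xs)
  case 0
  then show ?case by (cases xs) (auto simp: pmf_return)
next
  case (Suc n)
  show ?case
  proof (cases xs)
    case Nil
    have "[] \<notin> set_pmf (replicate_pmf (Suc n) p)" by (auto simp: set_replicate_pmf simp del: replicate_pmf.simps)
    then show ?thesis using Nil by (simp add: set_pmf_iff del: replicate_pmf.simps)
  next
    case (Cons y ys)
    have "pmf (map_pmf (\<lambda>(x, xs). x # xs) (pair_pmf p (replicate_pmf n p))) ((\<lambda>(x, xs). x # xs) (y, ys))
        = pmf (pair_pmf p (replicate_pmf n p)) (y, ys)"
      by (rule pmf_map_inj') (auto simp: inj_def)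
    then show ?thesis using Cons Suc.IH[of ys] unfolding replicate_pmf_Suc_pair by (simp add: pmf_pair)
  qed
qed

lemma simple_function_map_list:
  assumes "\<And>i. i \<in> set is \<Longrightarrow> simple_function M (\<lambda>\<omega>. h (\<omega> i))"
  shows "simple_function M (\<lambda>\<omega>. map (\<lambda>i. h (\<omega> i)) is)"
  using assms
proof (induction "is")
  case (Cons i "is")
  then have "simple_function M (\<lambda>\<omega>. h (\<omega> i) # map (\<lambda>i. h (\<omega> i)) is)"
    by (intro simple_function_compose2[where h="(#)"]) auto
  then show ?case by simp
qed simp

lemma simple_function_PiM_map:
  assumes "simple_function M h"
  shows "simple_function (PiM {..<N::nat} (\<lambda>_. M)) (\<lambda>\<omega>. map (\<lambda>i. h (\<omega> i)) [0..<N])"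
  by (rule simple_function_map_list)
    (auto intro!: simple_function_comp[OF _ assms] measurable_component_singleton)

text \<open>Both sides are discrete, so comparing point masses suffices.\<close>

lemma (in prob_space) distr_PiM_eq_replicate_pmf:
  assumes h: "simple_function M h" and \<nu>: "measure_pmf \<nu> = distr M (count_space UNIV) h"
  shows "distr (PiM {..<N::nat} (\<lambda>_. M)) (count_space UNIV) (\<lambda>\<omega>. map (\<lambda>i. h (\<omega> i)) [0..<N]) =
    measure_pmf (replicate_pmf N \<nu>)"
proof -
  interpret P: finite_product_prob_space "\<lambda>_::nat. M" "{..<N}"
    by unfold_locales simp
  let ?H = "\<lambda>\<omega>. map (\<lambda>i. h (\<omega> i)) [0..<N]"
  have [measurable]: "h \<in> measurable M (count_space UNIV)"
    using h by (rule measurable_simple_function)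
  have H: "simple_function (PiM {..<N} (\<lambda>_. M)) ?H" by (rule simple_function_PiM_map[OF h])
  have [measurable]: "?H \<in> measurable (PiM {..<N} (\<lambda>_. M)) (count_space UNIV)"
    using H by (rule measurable_simple_function)
  obtain q where q: "measure_pmf q = distr (PiM {..<N} (\<lambda>_. M)) (count_space UNIV) ?H"
    using P.P.simple_function_law[OF H] by blast
  have "q = replicate_pmf N \<nu>"
  proof (rule pmf_eqI)
    fix vs
    have "pmf q vs = measure (PiM {..<N} (\<lambda>_. M)) (?H -` {vs} \<inter> space (PiM {..<N} (\<lambda>_. M)))"
      by (simp add: pmf.rep_eq q measure_distr)
    also have "\<dots> = pmf (replicate_pmf N \<nu>) vs"
    proof (cases "length vs = N")
      case True
      \<comment> \<open>For a list of length \<open>N\<close> the event is a box with one side per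
        sample, on which the product measure multiplies.\<close>
      have "?H -` {vs} \<inter> space (PiM {..<N} (\<lambda>_. M)) = (\<Pi>\<^sub>E i\<in>{..<N}. h -` {vs ! i} \<inter> space M)"
      proof (intro set_eqI iffI)
        fix \<omega> assume "\<omega> \<in> ?H -` {vs} \<inter> space (PiM {..<N} (\<lambda>_. M))"
        then show "\<omega> \<in> (\<Pi>\<^sub>E i\<in>{..<N}. h -` {vs ! i} \<inter> space M)"
          by (auto simp: space_PiM PiE_iff)
      next
        fix \<omega> assume *: "\<omega> \<in> (\<Pi>\<^sub>E i\<in>{..<N}. h -` {vs ! i} \<inter> space M)"
        then have "?H \<omega> = vs"
          using True by (intro nth_equalityI) (auto simp: PiE_iff)
        then show "\<omega> \<in> ?H -` {vs} \<inter> space (PiM {..<N} (\<lambda>_. M))"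
          using * by (auto simp: space_PiM PiE_iff)
      qed
      also have "measure (PiM {..<N} (\<lambda>_. M)) \<dots> = (\<Prod>i<N. prob (h -` {vs ! i} \<inter> space M))"
        by (rule P.prob_times) auto
      also have "\<dots> = (\<Prod>i<N. pmf \<nu> (vs ! i))"
        by (simp add: pmf.rep_eq \<nu> measure_distr)
      also have "\<dots> = (\<Prod>x\<leftarrow>vs. pmf \<nu> x)"
        using True by (simp add: prod.list_conv_set_nth atLeast0LessThan)
      finally show ?thesis using True by (simp add: pmf_replicate_pmf)
    next
      case False
      then have "?H -` {vs} = {}" by auto
      then show ?thesis using False by (simp add: pmf_replicate_pmf)
    qed
    finally show "pmf q vs = pmf (replicate_pmf N \<nu>) vs" .
  qed
  then show ?thesis using q by simp
qed

lemma simple_function_map_prod: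
  assumes sets: "sets \<mu> = sets (S \<Otimes>\<^sub>M T)" and F: "simple_function S F" and G: "simple_function T G"
  shows "simple_function \<mu> (\<lambda>z. (F (fst z), G (snd z)))"
proof (rule simple_function_compose2[where h=Pair])
  show "simple_function \<mu> (\<lambda>z. F (fst z))"
    by (rule simple_function_comp[OF _ F]) (simp add: measurable_cong_sets[OF sets refl])
  show "simple_function \<mu> (\<lambda>z. G (snd z))"
    by (rule simple_function_comp[OF _ G]) (simp add: measurable_cong_sets[OF sets refl])
qed

section \<open>From simulations to simultaneous messages\<close>

text \<open>Each player applies the own simple function to every sample and then follows the
  simulation; the joint law of the discretised samples is
  \<open>replicate_pmf N \<nu>\<close>.\<close>

lemma has_smp_protocol_if_simulates:
  fixes S :: "'a measure" and T :: "'b measure" and \<mu> :: "('a \<times> 'b) measure"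
    and f :: "'x \<times> 'y \<rightharpoonup> bool" and D :: "'x \<Rightarrow> 'y \<Rightarrow> (bool list \<times> bool list) pmf"
  assumes \<mu>: "prob_space \<mu>" "sets \<mu> = sets (S \<Otimes>\<^sub>M T)"
    and F: "simple_function S F" and G: "simple_function T G"
    and \<nu>: "measure_pmf \<nu> = distr \<mu> (count_space UNIV) (\<lambda>z. (F (fst z), G (snd z)))"
    and sim: "simulates \<nu> D"
    and len: "\<And>x y z. z \<in> set_pmf (D x y) \<Longrightarrow> length (fst z) = k \<and> length (snd z) = l"
    and correct: "\<And>x y v. f (x, y) = Some v \<Longrightarrow>
       1 - \<delta> \<le> measure_pmf.prob (D x y) {z. referee (fst z) (snd z) = v}"
  shows "has_smp_protocol S T \<mu> f \<delta> (k + l)"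
proof -
  interpret prob_space \<mu> by fact
  obtain N \<alpha> \<beta> where D: "\<And>x y. D x y =
      map_pmf (\<lambda>zs. (\<alpha> x (map fst zs), \<beta> y (map snd zs))) (replicate_pmf N \<nu>)"
    using sim unfolding simulates_def by blast
  \<comment> \<open>Messages must have the prescribed length for every sample sequence, whereas
    \<open>len\<close> speaks of the support only. Off the support a default message is sent, which
    changes no probability.\<close>
  define pad where "pad n bs = (if length bs = n then bs else replicate n False)" for n and bs :: "bool list"
  define alice where "alice x s = pad k (\<alpha> x (map (\<lambda>i. F (s i)) [0..<N]))" for x s
  define bob where "bob y s = pad l (\<beta> y (map (\<lambda>i. G (s i)) [0..<N]))" for y s
  define h where "h = (\<lambda>z. (F (fst z), G (snd z)))"
  have simple_h: "simple_function \<mu> h"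
    unfolding h_def by (rule simple_function_map_prod[OF \<mu>(2) F G])
  have alice: "alice x \<in> measurable (PiM {..<N} (\<lambda>_. S)) (count_space UNIV)" for x
    unfolding alice_def
    by (rule measurable_simple_function,
        rule simple_function_compose1[where g="\<lambda>bs. pad k (\<alpha> x bs)", OF simple_function_PiM_map[OF F]])
  have bob: "bob y \<in> measurable (PiM {..<N} (\<lambda>_. T)) (count_space UNIV)" for y
    unfolding bob_def
    by (rule measurable_simple_function,
        rule simple_function_compose1[where g="\<lambda>bs. pad l (\<beta> y bs)", OF simple_function_PiM_map[OF G]])
  have "1 - \<delta> \<le> measure (PiM {..<N} (\<lambda>_. \<mu>))
             {\<omega> \<in> space (PiM {..<N} (\<lambda>_. \<mu>)).
                referee (alice x (\<lambda>i\<in>{..<N}. fst (\<omega> i))) (bob y (\<lambda>i\<in>{..<N}. snd (\<omega> i))) = v}"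
    if f: "f (x, y) = Some v" for x y v
  proof -
    define A where "A = {zs. referee (pad k (\<alpha> x (map fst zs))) (pad l (\<beta> y (map snd zs))) = v}"
    let ?H = "\<lambda>\<omega>. map (\<lambda>i. h (\<omega> i)) [0..<N]"
    have "1 - \<delta> \<le> measure_pmf.prob (replicate_pmf N \<nu>)
        {zs. referee (\<alpha> x (map fst zs)) (\<beta> y (map snd zs)) = v}"
      using correct[OF f] by (simp add: D vimage_def)
    also have "\<dots> = measure_pmf.prob (replicate_pmf N \<nu>) A"
    proof (rule measure_pmf.finite_measure_eq_AE)
      show "AE zs in replicate_pmf N \<nu>. (zs \<in> {zs. referee (\<alpha> x (map fst zs)) (\<beta> y (map snd zs)) = v}) = (zs \<in> A)"
      proof (rule AE_pmfI)
        fix zs assume "zs \<in> set_pmf (replicate_pmf N \<nu>)"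
        then have "length (\<alpha> x (map fst zs)) = k" "length (\<beta> y (map snd zs)) = l"
          using len[of "(\<alpha> x (map fst zs), \<beta> y (map snd zs))" x y] by (auto simp: D)
        then show "(zs \<in> {zs. referee (\<alpha> x (map fst zs)) (\<beta> y (map snd zs)) = v}) = (zs \<in> A)"
          by (simp add: A_def pad_def)
      qed
    qed auto
    also have "\<dots> = measure (distr (PiM {..<N} (\<lambda>_. \<mu>)) (count_space UNIV) ?H) A"
      using distr_PiM_eq_replicate_pmf[OF simple_h \<nu>[folded h_def], of N] by simp
    also have "\<dots> = measure (PiM {..<N} (\<lambda>_. \<mu>)) (?H -` A \<inter> space (PiM {..<N} (\<lambda>_. \<mu>)))"
      by (rule measure_distr) (simp_all add: measurable_simple_function[OF simple_function_PiM_map[OF simple_h]])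
    also have "?H -` A \<inter> space (PiM {..<N} (\<lambda>_. \<mu>)) = {\<omega> \<in> space (PiM {..<N} (\<lambda>_. \<mu>)).
                referee (alice x (\<lambda>i\<in>{..<N}. fst (\<omega> i))) (bob y (\<lambda>i\<in>{..<N}. snd (\<omega> i))) = v}"
    proof -
      have "map (\<lambda>i. F ((\<lambda>i\<in>{..<N}. fst (\<omega> i)) i)) [0..<N] = map fst (?H \<omega>)"
        "map (\<lambda>i. G ((\<lambda>i\<in>{..<N}. snd (\<omega> i)) i)) [0..<N] = map snd (?H \<omega>)" for \<omega>
        by (auto simp: h_def)
      then show ?thesis by (auto simp: A_def alice_def bob_def simp del: map_map)
    qed
    finally show ?thesis .
  qed
  then show ?thesis
    unfolding has_smp_protocol_def
    using alice bob
    by (intro exI[of _ N] exI[of _ k] exI[of _ l] exI[of _ alice] exI[of _ bob] exI[of _ referee])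
      (auto simp: alice_def bob_def pad_def)
qed

subsection \<open>The protocol\<close>

lemma (in prob_space) integrable_if_integrable_square:
  fixes F :: "'a \<Rightarrow> real"
  assumes "F \<in> borel_measurable M" and "integrable M (\<lambda>z. (F z)\<^sup>2)"
  shows "integrable M F"
proof (rule Bochner_Integration.integrable_bound[where f="\<lambda>z. 1 + (F z)\<^sup>2"])
  show "AE z in M. norm (F z) \<le> norm (1 + (F z)\<^sup>2)"
  proof (rule AE_I2)
    fix z
    have "0 \<le> (\<bar>F z\<bar> - 1)\<^sup>2" by simp
    then have "2 * \<bar>F z\<bar> \<le> 1 + (F z)\<^sup>2" by (simp add: power2_diff)
    then have "\<bar>F z\<bar> \<le> 1 + (F z)\<^sup>2" by linarith
    then show "norm (F z) \<le> norm (1 + (F z)\<^sup>2)" by simp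
  qed
qed (use assms in auto)

text \<open>\<open>F\<close> and \<open>G\<close> are approximated separately, so each approximant
  stays a function of one player's component. Dominated convergence handles all moments; covariances
  are compared because the approximants need not be centred.\<close>

lemma (in prob_space) simple_approximation:
  fixes S :: "'b measure" and T :: "'c measure" and F :: "'b \<Rightarrow> real" and G :: "'c \<Rightarrow> real"
  assumes [measurable]: "X \<in> measurable M S" "Y \<in> measurable M T" "F \<in> borel_measurable S" "G \<in> borel_measurable T"
    and F2: "integrable M (\<lambda>z. (F (X z))\<^sup>2)" and G2: "integrable M (\<lambda>z. (G (Y z))\<^sup>2)" and \<eta>: "0 < \<eta>"
  shows "\<exists>F' G'. simple_function S F' \<and> simple_function T G' \<and>
    expectation (\<lambda>z. (F' (X z))\<^sup>2) < expectation (\<lambda>z. (F (X z))\<^sup>2) + \<eta> \<and>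
    expectation (\<lambda>z. (G' (Y z))\<^sup>2) < expectation (\<lambda>z. (G (Y z))\<^sup>2) + \<eta> \<and>
    expectation (\<lambda>z. F (X z) * G (Y z)) - expectation (\<lambda>z. F (X z)) * expectation (\<lambda>z. G (Y z)) - \<eta> <
      expectation (\<lambda>z. F' (X z) * G' (Y z)) - expectation (\<lambda>z. F' (X z)) * expectation (\<lambda>z. G' (Y z))"
proof -
  obtain Fs where Fs: "\<And>i. simple_function S (Fs i)" "\<And>s. s \<in> space S \<Longrightarrow> (\<lambda>i. Fs i s) \<longlonglongrightarrow> F s"
    "\<And>i s. s \<in> space S \<Longrightarrow> \<bar>Fs i s\<bar> \<le> 2 * \<bar>F s\<bar>"
    using borel_measurable_implies_sequence_metric[OF assms(3), of 0] by (auto simp: Ball_def)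
  obtain Gs where Gs: "\<And>i. simple_function T (Gs i)" "\<And>s. s \<in> space T \<Longrightarrow> (\<lambda>i. Gs i s) \<longlonglongrightarrow> G s"
    "\<And>i s. s \<in> space T \<Longrightarrow> \<bar>Gs i s\<bar> \<le> 2 * \<bar>G s\<bar>"
    using borel_measurable_implies_sequence_metric[OF assms(4), of 0] by (auto simp: Ball_def)
  have [measurable]: "Fs i \<in> borel_measurable S" "Gs i \<in> borel_measurable T" for i
    using Fs(1) Gs(1) by (auto intro: borel_measurable_simple_function)
  have X: "z \<in> space M \<Longrightarrow> X z \<in> space S" and Y: "z \<in> space M \<Longrightarrow> Y z \<in> space T" for z
    using measurable_space[OF assms(1)] measurable_space[OF assms(2)] by blast+
  have F1: "integrable M (\<lambda>z. F (X z))" and G1: "integrable M (\<lambda>z. G (Y z))"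
    using F2 G2 by (auto intro!: integrable_if_integrable_square)
  have lim_F: "(\<lambda>i. expectation (\<lambda>z. Fs i (X z))) \<longlonglongrightarrow> expectation (\<lambda>z. F (X z))"
    by (rule integral_dominated_convergence[where w="\<lambda>z. 2 * \<bar>F (X z)\<bar>"]) (use F1 Fs X in auto)
  have lim_G: "(\<lambda>i. expectation (\<lambda>z. Gs i (Y z))) \<longlonglongrightarrow> expectation (\<lambda>z. G (Y z))"
    by (rule integral_dominated_convergence[where w="\<lambda>z. 2 * \<bar>G (Y z)\<bar>"]) (use G1 Gs Y in auto)
  have sq: "\<bar>a\<^sup>2\<bar> \<le> 4 * b\<^sup>2" if "\<bar>a\<bar> \<le> 2 * \<bar>b\<bar>" for a b :: real
    using power_mono[OF that, of 2] by (simp add: power_mult_distrib)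
  have lim_F2: "(\<lambda>i. expectation (\<lambda>z. (Fs i (X z))\<^sup>2)) \<longlonglongrightarrow> expectation (\<lambda>z. (F (X z))\<^sup>2)"
  proof (rule integral_dominated_convergence[where w="\<lambda>z. 4 * (F (X z))\<^sup>2"])
    show "AE z in M. (\<lambda>i. (Fs i (X z))\<^sup>2) \<longlonglongrightarrow> (F (X z))\<^sup>2"
      using Fs(2) X by (auto intro!: tendsto_power)
    show "AE z in M. norm ((Fs i (X z))\<^sup>2) \<le> 4 * (F (X z))\<^sup>2" for i
      using sq[OF Fs(3)] X by auto
  qed (use F2 in auto)
  have lim_G2: "(\<lambda>i. expectation (\<lambda>z. (Gs i (Y z))\<^sup>2)) \<longlonglongrightarrow> expectation (\<lambda>z. (G (Y z))\<^sup>2)"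
  proof (rule integral_dominated_convergence[where w="\<lambda>z. 4 * (G (Y z))\<^sup>2"])
    show "AE z in M. (\<lambda>i. (Gs i (Y z))\<^sup>2) \<longlonglongrightarrow> (G (Y z))\<^sup>2"
      using Gs(2) Y by (auto intro!: tendsto_power)
    show "AE z in M. norm ((Gs i (Y z))\<^sup>2) \<le> 4 * (G (Y z))\<^sup>2" for i
      using sq[OF Gs(3)] Y by auto
  qed (use G2 in auto)
  \<comment> \<open>The product is dominated by means of \<open>4 * \<bar>F\<bar> * \<bar>G\<bar>
    \<le> 2 * (F\<^sup>2 + G\<^sup>2)\<close>, so square integrability is enough.\<close>
  have lim_FG: "(\<lambda>i. expectation (\<lambda>z. Fs i (X z) * Gs i (Y z))) \<longlonglongrightarrow> expectation (\<lambda>z. F (X z) * G (Y z))"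
  proof (rule integral_dominated_convergence[where w="\<lambda>z. 2 * ((F (X z))\<^sup>2 + (G (Y z))\<^sup>2)"])
    show "AE z in M. (\<lambda>i. Fs i (X z) * Gs i (Y z)) \<longlonglongrightarrow> F (X z) * G (Y z)"
      using Fs(2) Gs(2) X Y by (auto intro!: tendsto_mult)
    show "AE z in M. norm (Fs i (X z) * Gs i (Y z)) \<le> 2 * ((F (X z))\<^sup>2 + (G (Y z))\<^sup>2)" for i
    proof (rule AE_I2)
      fix z assume "z \<in> space M"
      then have "\<bar>Fs i (X z)\<bar> * \<bar>Gs i (Y z)\<bar> \<le> (2 * \<bar>F (X z)\<bar>) * (2 * \<bar>G (Y z)\<bar>)"
        using Fs(3) Gs(3) X Y by (intro mult_mono) auto
      also have "\<dots> \<le> 2 * ((F (X z))\<^sup>2 + (G (Y z))\<^sup>2)"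
        using zero_le_power2[of "\<bar>F (X z)\<bar> - \<bar>G (Y z)\<bar>"] by (simp add: power2_diff)
      finally show "norm (Fs i (X z) * Gs i (Y z)) \<le> 2 * ((F (X z))\<^sup>2 + (G (Y z))\<^sup>2)"
        by (simp add: abs_mult)
    qed
  qed (use F2 G2 in auto)
  have "\<forall>\<^sub>F i in sequentially. expectation (\<lambda>z. (Fs i (X z))\<^sup>2) < expectation (\<lambda>z. (F (X z))\<^sup>2) + \<eta>"
    using \<eta> by (intro order_tendstoD[OF lim_F2]) auto
  moreover have "\<forall>\<^sub>F i in sequentially. expectation (\<lambda>z. (Gs i (Y z))\<^sup>2) < expectation (\<lambda>z. (G (Y z))\<^sup>2) + \<eta>"
    using \<eta> by (intro order_tendstoD[OF lim_G2]) auto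
  moreover have "\<forall>\<^sub>F i in sequentially.
    expectation (\<lambda>z. F (X z) * G (Y z)) - expectation (\<lambda>z. F (X z)) * expectation (\<lambda>z. G (Y z)) - \<eta> <
      expectation (\<lambda>z. Fs i (X z) * Gs i (Y z)) - expectation (\<lambda>z. Fs i (X z)) * expectation (\<lambda>z. Gs i (Y z))"
    using \<eta> by (intro order_tendstoD(1)[OF tendsto_diff[OF lim_FG tendsto_mult[OF lim_F lim_G]]]) auto
  ultimately have "\<forall>\<^sub>F i in sequentially.
    expectation (\<lambda>z. (Fs i (X z))\<^sup>2) < expectation (\<lambda>z. (F (X z))\<^sup>2) + \<eta> \<and>
    expectation (\<lambda>z. (Gs i (Y z))\<^sup>2) < expectation (\<lambda>z. (G (Y z))\<^sup>2) + \<eta> \<and>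
    expectation (\<lambda>z. F (X z) * G (Y z)) - expectation (\<lambda>z. F (X z)) * expectation (\<lambda>z. G (Y z)) - \<eta> <
      expectation (\<lambda>z. Fs i (X z) * Gs i (Y z)) - expectation (\<lambda>z. Fs i (X z)) * expectation (\<lambda>z. Gs i (Y z))"
    by eventually_elim auto
  then obtain i where "expectation (\<lambda>z. (Fs i (X z))\<^sup>2) < expectation (\<lambda>z. (F (X z))\<^sup>2) + \<eta> \<and>
    expectation (\<lambda>z. (Gs i (Y z))\<^sup>2) < expectation (\<lambda>z. (G (Y z))\<^sup>2) + \<eta> \<and>
    expectation (\<lambda>z. F (X z) * G (Y z)) - expectation (\<lambda>z. F (X z)) * expectation (\<lambda>z. G (Y z)) - \<eta> <
      expectation (\<lambda>z. Fs i (X z) * Gs i (Y z)) - expectation (\<lambda>z. Fs i (X z)) * expectation (\<lambda>z. Gs i (Y z))"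
    using eventually_happens by force
  then show ?thesis using Fs(1) Gs(1) by blast
qed

lemma finite_source:
  fixes S :: "'a measure" and T :: "'b measure" and \<mu> :: "('a \<times> 'b) measure" and \<rho> :: real
  assumes \<mu>: "prob_space \<mu>" "sets \<mu> = sets (S \<Otimes>\<^sub>M T)" and \<rho>: "0 < \<rho>" "\<rho> \<le> 1"
    and mc: "maximal_correlation S T \<mu> = ereal \<rho>"
  shows "\<exists>F G \<nu>. simple_function S F \<and> simple_function T G \<and> finite (set_pmf \<nu>) \<and>
    measure_pmf \<nu> = distr \<mu> (count_space UNIV) (\<lambda>z. (F (fst z), G (snd z))) \<and>
    measure_pmf.expectation \<nu> (\<lambda>z. (fst z)\<^sup>2) \<le> 9/8 \<and>
    measure_pmf.expectation \<nu> (\<lambda>z. (snd z)\<^sup>2) \<le> 9/8 \<and>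
    3/4 * \<rho> \<le> measure_pmf.expectation \<nu> (\<lambda>z. fst z * snd z) -
      measure_pmf.expectation \<nu> fst * measure_pmf.expectation \<nu> (snd :: real \<times> real \<Rightarrow> real)"
proof -
  interpret prob_space \<mu> by fact
  \<comment> \<open>The supremum need not be attained. Going below it costs
    \<open>\<rho> / 8\<close> and the simple approximation another \<open>\<rho> / 8\<close>, which
    leaves \<open>3/4 * \<rho>\<close>.\<close>
  have "ereal (7/8 * \<rho>) < maximal_correlation S T \<mu>" using mc \<rho> by simp
  then obtain F G where [measurable]: "F \<in> borel_measurable S" "G \<in> borel_measurable T"
    and F: "standardized \<mu> (\<lambda>z. F (fst z))" and G: "standardized \<mu> (\<lambda>z. G (snd z))"
    and FG: "7/8 * \<rho> < expectation (\<lambda>z. F (fst z) * G (snd z))"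
    unfolding maximal_correlation_def less_SUP_iff by auto
  have [measurable]: "fst \<in> measurable \<mu> S" "snd \<in> measurable \<mu> T"
    by (simp_all add: measurable_cong_sets[OF \<mu>(2) refl])
  have sq: "integrable \<mu> (\<lambda>z. (F (fst z))\<^sup>2)" "expectation (\<lambda>z. F (fst z)) = 0" "expectation (\<lambda>z. (F (fst z))\<^sup>2) = 1"
    "integrable \<mu> (\<lambda>z. (G (snd z))\<^sup>2)" "expectation (\<lambda>z. G (snd z)) = 0" "expectation (\<lambda>z. (G (snd z))\<^sup>2) = 1"
    using F G by (auto simp: standardized_def)
  obtain F' G' where F'G': "simple_function S F'" "simple_function T G'"
    "expectation (\<lambda>z. (F' (fst z))\<^sup>2) < 1 + 1/8 * \<rho>" "expectation (\<lambda>z. (G' (snd z))\<^sup>2) < 1 + 1/8 * \<rho>"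
    "expectation (\<lambda>z. F (fst z) * G (snd z)) - 1/8 * \<rho> <
      expectation (\<lambda>z. F' (fst z) * G' (snd z)) - expectation (\<lambda>z. F' (fst z)) * expectation (\<lambda>z. G' (snd z))"
    using simple_approximation[of fst S snd T F G "1/8 * \<rho>"] sq \<rho> by auto
  define h where "h = (\<lambda>z :: 'a \<times> 'b. (F' (fst z), G' (snd z)))"
  have h: "simple_function \<mu> h"
    unfolding h_def by (rule simple_function_map_prod[OF \<mu>(2) F'G'(1,2)])
  then obtain \<nu> where \<nu>: "measure_pmf \<nu> = distr \<mu> (count_space UNIV) h" "finite (set_pmf \<nu>)"
    using simple_function_law by blast
  have E: "measure_pmf.expectation \<nu> g = expectation (\<lambda>z. g (h z))" for g :: "_ \<Rightarrow> real"
    unfolding \<nu>(1) by (rule integral_distr) (auto intro: measurable_simple_function[OF h])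
  have "expectation (\<lambda>z. (F' (fst z))\<^sup>2) \<le> 9/8" "expectation (\<lambda>z. (G' (snd z))\<^sup>2) \<le> 9/8"
    using F'G'(3,4) \<rho> by linarith+
  moreover have "3/4 * \<rho> \<le> expectation (\<lambda>z. F' (fst z) * G' (snd z)) - expectation (\<lambda>z. F' (fst z)) * expectation (\<lambda>z. G' (snd z))"
  proof -
    have "3/4 * \<rho> = 7/8 * \<rho> - 1/8 * \<rho>" by simp
    also have "\<dots> \<le> expectation (\<lambda>z. F (fst z) * G (snd z)) - 1/8 * \<rho>" using FG by simp
    also note F'G'(5)
    finally show ?thesis by simp
  qed
  ultimately have "measure_pmf.expectation \<nu> (\<lambda>z. (fst z)\<^sup>2) \<le> 9/8"
    "measure_pmf.expectation \<nu> (\<lambda>z. (snd z)\<^sup>2) \<le> 9/8"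
    "3/4 * \<rho> \<le> measure_pmf.expectation \<nu> (\<lambda>z. fst z * snd z) -
      measure_pmf.expectation \<nu> fst * measure_pmf.expectation \<nu> snd"
    unfolding E by (simp_all add: h_def)
  then show ?thesis
    using F'G'(1,2) \<nu> unfolding h_def by blast
qed

section \<open>Optimal public-coin protocols and protocols without communication\<close>

lemma public_coin_cc_attained:
  assumes "public_coin_cc \<epsilon> f = enat c"
  obtains P where "public_coin_computes \<epsilon> f P" and "\<And>t. t \<in> set_pmf P \<Longrightarrow> height t \<le> c"
proof -
  define C where "C = public_coin_cost ` {P. public_coin_computes \<epsilon> f P}"
  have inf: "Inf C = enat c" using assms by (simp add: public_coin_cc_def C_def)
  then have "C \<noteq> {}" by (auto simp: Inf_enat_def)
  \<comment> \<open>Costs lie in the well-ordered type \<open>enat\<close>, so the infimum is a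
    minimum; the set is nonempty since its infimum is finite.\<close>
  then have "Inf C \<in> C" unfolding Inf_enat_def using LeastI[of "\<lambda>x. x \<in> C"] by auto
  then obtain P where P: "public_coin_computes \<epsilon> f P" "public_coin_cost P = enat c"
    using inf by (auto simp: C_def)
  have "height t \<le> c" if "t \<in> set_pmf P" for t
  proof -
    have "enat (height t) \<le> public_coin_cost P"
      unfolding public_coin_cost_def using that by (rule SUP_upper)
    then show ?thesis using P by simp
  qed
  then show ?thesis using that P by blast
qed

text \<open>Without communication the answer ignores the inputs, and both answers cannot have
  probability at least 2/3. This serves \<open>c = 0\<close>, where \<open>2 ^ (20 * c)\<close> is 1
  and absorbs no constants.\<close>

lemma height_0_constant:
  fixes f :: "'x \<times> 'y \<rightharpoonup> bool"
  assumes computes: "public_coin_computes (1/3) f P" and height: "\<And>t. t \<in> set_pmf P \<Longrightarrow> height t \<le> 0"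
  shows "\<exists>w. \<forall>x y v. f (x, y) = Some v \<longrightarrow> v = w"
proof (rule ccontr)
  assume "\<not> ?thesis"
  then obtain x y x' y' where f: "f (x, y) = Some True" "f (x', y') = Some False"
    by (metis (full_types))
  have "measure_pmf.prob P {t. run t x' y' = False} = measure_pmf.prob P (- {t. run t x y = True})"
  proof (rule measure_pmf.finite_measure_eq_AE)
    have "run t x y = run t x' y'" if "t \<in> set_pmf P" for t
      using height[OF that] by (cases t) auto
    then show "AE t in P. (t \<in> {t. run t x' y' = False}) = (t \<in> - {t. run t x y = True})"
      by (intro AE_pmfI) auto
  qed auto
  also have "\<dots> = 1 - measure_pmf.prob P {t. run t x y = True}"
    using measure_pmf.prob_compl[of "{t. run t x y = True}" P] by (simp add: Compl_eq_Diff_UNIV)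
  finally have "measure_pmf.prob P {t. run t x' y' = False} + measure_pmf.prob P {t. run t x y = True} = 1"
    by simp
  moreover have "2/3 \<le> measure_pmf.prob P {t. run t x' y' = False}" "2/3 \<le> measure_pmf.prob P {t. run t x y = True}"
    using computes f unfolding public_coin_computes_def by force+
  ultimately show False by linarith
qed

section \<open>Majority votes, guessing and the count of bits\<close>

lemma majority_protocol:
  fixes \<nu> :: "('s \<times> 't) pmf" and f :: "'x \<times> 'y \<rightharpoonup> bool" and D :: "'x \<Rightarrow> 'y \<Rightarrow> (bool \<times> bool) pmf"
  assumes fin: "finite (set_pmf \<nu>)" and sim: "simulates \<nu> D" and m: "0 \<le> m"
    and mean: "\<And>x y v. f (x, y) = Some v \<Longrightarrow> m \<le> measure_pmf.expectation (D x y) (\<lambda>(a, b). spin ((a = b) = v))"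
    and n: "exp (- (m\<^sup>2 * real n / 2)) \<le> \<delta>"
  shows "\<exists>D' :: 'x \<Rightarrow> 'y \<Rightarrow> (bool list \<times> bool list) pmf. \<exists>referee. simulates \<nu> D' \<and>
    (\<forall>x y. \<forall>z\<in>set_pmf (D' x y). length (fst z) = n \<and> length (snd z) = n) \<and>
    (\<forall>x y v. f (x, y) = Some v \<longrightarrow> 1 - \<delta> \<le> measure_pmf.prob (D' x y) {z. referee (fst z) (snd z) = v})"
proof -
  define D' where "D' x y = map_pmf (\<lambda>zs. (map fst zs, map snd zs)) (replicate_pmf n (D x y))" for x y
  \<comment> \<open>The vote is on whether the players' bits agree. Resolving ties to
    \<open>False\<close> is harmless because \<open>bad\<close> already counts them as
    errors.\<close>
  define referee where "referee as bs \<longleftrightarrow> 0 < (\<Sum>(a, b)\<leftarrow>zip as bs. spin (a = b))" for as bs :: "bool list"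
  have "simulates \<nu> D'" unfolding D'_def by (rule simulates_replicate[OF sim])
  moreover have "\<forall>x y. \<forall>z\<in>set_pmf (D' x y). length (fst z) = n \<and> length (snd z) = n"
    by (auto simp: D'_def set_replicate_pmf)
  moreover have "1 - \<delta> \<le> measure_pmf.prob (D' x y) {z. referee (fst z) (snd z) = v}"
    if f: "f (x, y) = Some v" for x y v
  proof -
    define bad where "bad = {zs :: (bool \<times> bool) list. (\<Sum>z\<leftarrow>zs. spin ((fst z = snd z) = v)) \<le> 0}"
    have "measure_pmf.prob (replicate_pmf n (D x y)) bad \<le> exp (- (m\<^sup>2 * real n / 2))"
      unfolding bad_def using mean[OF f] finite_set_pmf_simulates[OF sim fin] m
      by (intro prob_majority_error) (auto simp: case_prod_unfold)
    then have "1 - \<delta> \<le> 1 - measure_pmf.prob (replicate_pmf n (D x y)) bad" using n by linarith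
    also have "\<dots> = measure_pmf.prob (replicate_pmf n (D x y)) (- bad)"
      using measure_pmf.prob_compl[of bad "replicate_pmf n (D x y)"] by (simp add: Compl_eq_Diff_UNIV)
    also have "\<dots> \<le> measure_pmf.prob (replicate_pmf n (D x y)) {zs. referee (map fst zs) (map snd zs) = v}"
    proof (rule measure_pmf.finite_measure_mono)
      have "(\<Sum>z\<leftarrow>zs. spin ((fst z = snd z) = v)) = spin v * (\<Sum>z\<leftarrow>zs. spin (fst z = snd z))"
        for zs :: "(bool \<times> bool) list"
        by (induction zs) (auto simp: spin_def)
      then show "- bad \<subseteq> {zs. referee (map fst zs) (map snd zs) = v}"
        by (cases v) (auto simp: bad_def referee_def zip_map_fst_snd case_prod_unfold spin_def)
    qed simp
    also have "\<dots> = measure_pmf.prob (D' x y) {z. referee (fst z) (snd z) = v}"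
      by (simp add: D'_def vimage_def)
    finally show ?thesis .
  qed
  ultimately show ?thesis by blast
qed

text \<open>For \<open>\<delta> > 1/2\<close> an almost fair guess suffices: tolerance
  \<open>2 * \<delta> - 1\<close> puts the probability of either answer at no less than
  \<open>1 - \<delta>\<close>. The guess comes from Alice's samples, as the referee has no
  randomness.\<close>

lemma one_bit_protocol:
  fixes \<nu> :: "('s \<times> 't) pmf"
  assumes fin: "finite (set_pmf \<nu>)"
    and s: "s1 \<in> fst ` set_pmf \<nu>" "s2 \<in> fst ` set_pmf \<nu>" "s1 \<noteq> s2" and \<delta>: "1/2 < \<delta>"
  shows "\<exists>D :: 'x \<Rightarrow> 'y \<Rightarrow> (bool list \<times> bool list) pmf. simulates \<nu> D \<and>
    (\<forall>x y. \<forall>z\<in>set_pmf (D x y). length (fst z) = 1 \<and> length (snd z) = 0) \<and>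
    (\<forall>x y v. 1 - \<delta> \<le> measure_pmf.prob (D x y) {z. hd (fst z) = v})"
proof -
  obtain n W where "\<forall>u. \<bar>u\<bar> \<le> 1 \<longrightarrow>
      \<bar>measure_pmf.expectation (replicate_pmf n (map_pmf fst \<nu>)) (\<lambda>zs. spin (zs \<in> W u)) - u\<bar> \<le> 2 * \<delta> - 1"
    using ex_randomized_rounding[of "map_pmf fst \<nu>" s1 s2 "2 * \<delta> - 1"] fin s \<delta> by auto
  then have W: "\<bar>2 * measure_pmf.prob (replicate_pmf n (map_pmf fst \<nu>)) (W 0) - 1\<bar> \<le> 2 * \<delta> - 1"
    by (auto simp: expectation_spin dest: spec[of _ 0])
  define D :: "'x \<Rightarrow> 'y \<Rightarrow> (bool list \<times> bool list) pmf" where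
    "D x y = map_pmf (map_prod (\<lambda>as. [as \<in> W 0]) (\<lambda>_. []))
      (map_pmf (\<lambda>zs. (map fst zs, map snd zs)) (replicate_pmf n \<nu>))" for x y
  have "simulates \<nu> D"
    unfolding D_def by (intro simulates_map_prod simulates_replicate simulates_self)
  moreover have "\<forall>x y. \<forall>z\<in>set_pmf (D x y). length (fst z) = 1 \<and> length (snd z) = 0"
    by (auto simp: D_def)
  moreover have "1 - \<delta> \<le> measure_pmf.prob (D x y) {z. hd (fst z) = v}" for x y v
  proof -
    have "measure_pmf.prob (D x y) {z. hd (fst z) = v} =
      measure_pmf.prob (replicate_pmf n (map_pmf fst \<nu>)) {as. (as \<in> W 0) = v}"
      by (simp add: D_def vimage_def flip: map_replicate_pmf)
    moreover have "measure_pmf.prob p (- A) = 1 - measure_pmf.prob p A" for p and A :: "'s list set"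
      using measure_pmf.prob_compl[of A p] by (simp add: Compl_eq_Diff_UNIV)
    ultimately show ?thesis using W by (cases v) (auto simp: abs_le_iff Compl_eq[symmetric])
  qed
  ultimately show ?thesis by blast
qed

theorem theoremD1:
  fixes S :: "'a measure" and T :: "'b measure" and \<mu> :: "('a \<times> 'b) measure"
    and f :: "'x \<times> 'y \<rightharpoonup> bool" and \<rho> \<delta> :: real and c :: nat
  assumes "prob_space \<mu>" and "sets \<mu> = sets (S \<Otimes>\<^sub>M T)"
    and "0 < \<rho>" and "\<rho> \<le> 1"
    and "maximal_correlation S T \<mu> = ereal \<rho>"
    and "public_coin_cc (1/3) f = enat c"
    and "0 < \<delta>"
  shows "\<exists>bits. has_smp_protocol S T \<mu> f \<delta> bits \<and>
           real bits \<le> max 1 (2 ^ (20 * c) * log 2 (1 / \<delta>) / \<rho>\<^sup>2)"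
proof -
  note \<rho> = assms(3,4)
  obtain P where P: "public_coin_computes (1/3) f P" "\<And>t. t \<in> set_pmf P \<Longrightarrow> height t \<le> c"
    using public_coin_cc_attained[OF assms(6)] by blast
  obtain F G \<nu> where F: "simple_function S F" and G: "simple_function T G" and fin: "finite (set_pmf \<nu>)"
    and \<nu>: "measure_pmf \<nu> = distr \<mu> (count_space UNIV) (\<lambda>z. (F (fst z), G (snd z)))"
    and X: "measure_pmf.expectation \<nu> (\<lambda>z. (fst z)\<^sup>2) \<le> 9/8"
    and Y: "measure_pmf.expectation \<nu> (\<lambda>z. (snd z)\<^sup>2) \<le> 9/8"
    and cov: "3/4 * \<rho> \<le> measure_pmf.expectation \<nu> (\<lambda>z. fst z * snd z) -
      measure_pmf.expectation \<nu> fst * measure_pmf.expectation \<nu> (snd :: real \<times> real \<Rightarrow> real)"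
    using finite_source[OF assms(1-5)] by blast
  note smp = has_smp_protocol_if_simulates[OF assms(1,2) F G \<nu>]
  \<comment> \<open>The bound may be as small as 1 in the first case and lacks a large factor in the
    second; in the third, the exponent \<open>20 * c\<close> absorbs all constants.\<close>
  consider "1/2 < \<delta>" | "\<delta> \<le> 1/2" "c = 0" | "\<delta> \<le> 1/2" "1 \<le> c" by linarith
  then show ?thesis
  proof cases
    case 1
    have "measure_pmf.expectation \<nu> fst * measure_pmf.expectation \<nu> snd < measure_pmf.expectation \<nu> (\<lambda>z. fst z * snd z)"
      using cov \<rho> by linarith
    from covariance_pos_imp_nonconstant[OF fin this]
    obtain s1 s2 where s: "s1 \<in> fst ` set_pmf \<nu>" "s2 \<in> fst ` set_pmf \<nu>" "s1 \<noteq> s2" by blast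
    from one_bit_protocol[OF fin s 1, where 'x='x and 'y='y]
    obtain D :: "'x \<Rightarrow> 'y \<Rightarrow> (bool list \<times> bool list) pmf" where D: "simulates \<nu> D"
      "\<forall>x y. \<forall>z\<in>set_pmf (D x y). length (fst z) = 1 \<and> length (snd z) = 0"
      "\<forall>x y v. 1 - \<delta> \<le> measure_pmf.prob (D x y) {z. hd (fst z) = v}"
      by blast
    have "has_smp_protocol S T \<mu> f \<delta> (1 + 0)"
      using D by (intro smp[where referee="\<lambda>as bs. hd as"]) auto
    then show ?thesis by (intro exI[of _ 1]) auto
  next
    case 2
    then obtain w where w: "\<forall>x y v. f (x, y) = Some v \<longrightarrow> v = w"
      using height_0_constant[OF P(1)] P(2) by blast
    have "has_smp_protocol S T \<mu> f \<delta> (0 + 0)"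
      using w assms(7)
      by (intro smp[where referee="\<lambda>_ _. w", OF simulates_const[of \<nu> "[]" "[]"]]) auto
    then show ?thesis by (intro exI[of _ 0]) auto
  next
    case 3
    define L where "L = log 2 (1 / \<delta>)"
    define m where "m = \<rho> / (128 * 2 ^ c)"
    \<comment> \<open>The least number of repetitions for which the Chernoff exponent
      \<open>m\<^sup>2 * n / 2\<close> reaches \<open>ln (1 / \<delta>)\<close>.\<close>
    define n where "n = nat \<lceil>2 * ln (1 / \<delta>) / m\<^sup>2\<rceil>"
    have m: "0 < m" using \<rho> by (simp add: m_def)
    have ln_pos: "0 \<le> ln (1 / \<delta>)" using 3(1) assms(7) by simp
    \<comment> \<open>Here \<open>\<delta> \<le> 1/2\<close> enters: the additive loss from rounding
      \<open>n\<close> up can be absorbed into a multiple of \<open>L\<close>.\<close>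
    have L1: "1 \<le> L" using 3(1) assms(7) by (simp add: L_def le_log_iff field_simps)
    have "ln (1 / \<delta>) = ln 2 * L" by (simp add: L_def log_def)
    also have "\<dots> \<le> 1 * L" using L1 ln_2_less_1 by (intro mult_right_mono) auto
    finally have ln_le: "ln (1 / \<delta>) \<le> L" by simp
    have n: "2 * ln (1 / \<delta>) / m\<^sup>2 \<le> real n" "real n \<le> 2 * ln (1 / \<delta>) / m\<^sup>2 + 1"
      using ln_pos by (auto simp: n_def real_nat_ceiling_ge of_nat_nat)
    have "exp (- (m\<^sup>2 * real n / 2)) \<le> \<delta>"
    proof -
      have "ln (1 / \<delta>) \<le> m\<^sup>2 * real n / 2" using n(1) m by (simp add: field_simps)
      then have "exp (- (m\<^sup>2 * real n / 2)) \<le> exp (- ln (1 / \<delta>))" by simp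
      also have "\<dots> = \<delta>" using assms(7) by (simp add: ln_div)
      finally show ?thesis .
    qed
    moreover obtain D :: "'x \<Rightarrow> 'y \<Rightarrow> (bool \<times> bool) pmf" where D: "simulates \<nu> D"
      "\<And>x y v. f (x, y) = Some v \<Longrightarrow> m \<le> measure_pmf.expectation (D x y) (\<lambda>(a, b). spin ((a = b) = v))"
      using correlated_bits[OF fin X Y cov \<rho> P] unfolding m_def by blast
    ultimately obtain D' :: "'x \<Rightarrow> 'y \<Rightarrow> (bool list \<times> bool list) pmf" and referee where D': "simulates \<nu> D'"
      "\<forall>x y. \<forall>z\<in>set_pmf (D' x y). length (fst z) = n \<and> length (snd z) = n"
      "\<forall>x y v. f (x, y) = Some v \<longrightarrow> 1 - \<delta> \<le> measure_pmf.prob (D' x y) {z. referee (fst z) (snd z) = v}"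
      using majority_protocol[OF fin D(1) less_imp_le[OF m], of f n \<delta>] by blast
    have "has_smp_protocol S T \<mu> f \<delta> (n + n)"
      using D' by (intro smp[where referee=referee]) auto
    moreover have "real (n + n) \<le> 2 ^ (20 * c) * L / \<rho>\<^sup>2"
    proof -
      \<comment> \<open>\<open>n\<close> bits from each player account for the 4, and
        \<open>4 * 128\<^sup>2 = 2 ^ 16\<close>.\<close>
      have "4 * ln (1 / \<delta>) / m\<^sup>2 = 2 ^ (16 + 2 * c) * (ln (1 / \<delta>) / \<rho>\<^sup>2)"
        by (simp add: m_def power_divide power_mult_distrib power_add mult.commute flip: power_mult)
      also have "\<dots> \<le> 2 ^ (16 + 2 * c) * (L / \<rho>\<^sup>2)"
        using ln_le by (intro mult_left_mono divide_right_mono) auto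
      finally have main: "4 * ln (1 / \<delta>) / m\<^sup>2 \<le> 2 ^ (16 + 2 * c) * (L / \<rho>\<^sup>2)" .
      have "\<rho>\<^sup>2 \<le> 1" using \<rho> by (simp add: power_le_one)
      then have "1 \<le> L / \<rho>\<^sup>2" using L1 \<rho> by (simp add: le_divide_eq)
      moreover have "(2::real) ^ 1 \<le> 2 ^ (16 + 2 * c)" by (rule power_increasing) auto
      ultimately have "2 * 1 \<le> 2 ^ (16 + 2 * c) * (L / \<rho>\<^sup>2)" by (intro mult_mono) auto
      moreover have "real (n + n) \<le> 4 * ln (1 / \<delta>) / m\<^sup>2 + 2" using n(2) by simp
      ultimately have "real (n + n) \<le> 2 ^ (16 + 2 * c) * (L / \<rho>\<^sup>2) + 2 ^ (16 + 2 * c) * (L / \<rho>\<^sup>2)"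
        using main by linarith
      also have "2 ^ (16 + 2 * c) * (L / \<rho>\<^sup>2) + 2 ^ (16 + 2 * c) * (L / \<rho>\<^sup>2) = 2 ^ (17 + 2 * c) * (L / \<rho>\<^sup>2)"
        by (simp add: power_add)
      \<comment> \<open>The comparison \<open>17 + 2 * c \<le> 20 * c\<close> holds from
        \<open>c = 1\<close> on.\<close>
      also have "\<dots> \<le> 2 ^ (20 * c) * (L / \<rho>\<^sup>2)"
        using 3(2) L1 by (intro mult_right_mono power_increasing) auto
      finally show ?thesis by simp
    qed
    ultimately show ?thesis by (intro exI[of _ "n + n"]) (auto simp: L_def)
  qed
qed

end
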